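(* Let $1<p<\infty$, $\lambda_1,\dots,\lambda_N>0$ with $\sum_{i=1}^N\lambda_i=1$, and let $\mu\in\mathcal{P}_p(\mathbb{R}^d)$ with $\mu\ll\mathcal{L}^d$. Let $A_1,\dots,A_N$ be real $d\times d$ matrices, $v_1,\dots,v_N\in\mathbb{R}^d$, and let $\mu_i=(A_i\,\cdot+v_i)_\#\mu$ for $i=1,\dots,N$. Assume that one of the following two cases holds. (a) $A_i=\mathrm{Id}$ for every $i=1,\dots,N$. (b) There is $v\in\mathbb{R}^d$ with $v_i=v$ for every $i=1,\dots,N$, and: - $A_1$ is invertible; - the $A_i$ are symmetric and positive semidefinite; - for every $i$, $\sigma(A_i)\subset\{1,\zeta_i\}$ for some $\zeta_i\in[0,\infty)$; - the matrices commute, i.e. $[A_i,A_j]=0$ for every $i,j=1,\dots,N$, and the eigenspaces associated with the eigenvalue $1$ of all the $A_j\neq\mathrm{Id}$ coincide. Then the $p$-Wasserstein barycenter of $(\mu_i,\lambda_i)_{i=1,\dots,N}$ is $$\overline{\nu}_p=\big(\overline{A}\,\cdot+\overline{v}\big)_\#\mu,\qquad \overline{A}:=\overline{x}_p(A_1,\dots,A_N),\quad \overline{v}:=\overline{x}_p(v_1,\dots,v_N).$$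
   Context: $\mathcal{L}^d$ is Lebesgue measure; $\mathcal{P}_p(\mathbb{R}^d)$ is the set of Borel probability measures with finite $p$-th moment; $W_p$ is the $p$-Wasserstein distance; $\sigma(A)$ is the spectrum of $A$. The $p$-Wasserstein barycenter of $(\mu_i,\lambda_i)_i$ is the minimizer of $\nu\mapsto\sum_i\lambda_iW_p^p(\mu_i,\nu)$ over $\mathcal{P}_p(\mathbb{R}^d)$. For vectors, $\overline{x}_p(v_1,\dots,v_N):=\operatorname{argmin}_{z\in\mathbb{R}^d}\sum_i\lambda_i|v_i-z|^p$. For $d\times d$ matrices, $\overline{x}_p(A_1,\dots,A_N):=\operatorname{argmin}_{B}\sum_i\lambda_i|A_i-B|^p$, the minimum being over all real $d\times d$ matrices $B$, with $|A|:=\operatorname{Tr}(A^TA)^{1/2}=\big(\sum_{k,l}A_{kl}^2\big)^{1/2}$. Both minimizers are unique. *)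

theory Defs
  imports "HOL-Probability.Probability"
begin

definition prob_measures_p :: "real \<Rightarrow> 'a::euclidean_space measure set" where
  "prob_measures_p p =
     {\<mu>. prob_space \<mu> \<and> sets \<mu> = sets borel \<and> integrable \<mu> (\<lambda>x. norm x powr p)}"

definition transport_plans ::
    "'a::euclidean_space measure \<Rightarrow> 'a measure \<Rightarrow> ('a \<times> 'a) measure set" where
  "transport_plans \<mu> \<nu> =
     {\<pi>. sets \<pi> = sets borel \<and> distr \<pi> borel fst = \<mu> \<and> distr \<pi> borel snd = \<nu>}"

text \<open>
  The infimum is taken in the extended nonnegative reals. It is finite for measures with finite
  \<open>p\<close>-th moment, the only ones to which the distance is applied; the conversion to a real number
  loses information only when the infimum is infinite.
\<close>

definition wasserstein_dist ::
    "real \<Rightarrow> 'a::euclidean_space measure \<Rightarrow> 'a measure \<Rightarrow> real" where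
  "wasserstein_dist p \<mu> \<nu> =
     enn2real (INF \<pi>\<in>transport_plans \<mu> \<nu>. \<integral>\<^sup>+ z. ennreal (dist (fst z) (snd z) powr p) \<partial>\<pi>)
       powr (1 / p)"

text \<open>
  The set of all minimizers; a measure is ``the'' barycenter when this set is a singleton.
\<close>

definition wasserstein_barycenters ::
    "real \<Rightarrow> nat \<Rightarrow> (nat \<Rightarrow> real) \<Rightarrow> (nat \<Rightarrow> 'a::euclidean_space measure) \<Rightarrow> 'a measure set" where
  "wasserstein_barycenters p N w \<mu> =
     {\<nu>. is_arg_min (\<lambda>\<nu>. \<Sum>i=1..N. w i * wasserstein_dist p (\<mu> i) \<nu> powr p)
           (\<lambda>\<nu>. \<nu> \<in> prob_measures_p p) \<nu>}"

text \<open>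
  Used both for vectors and for matrices: the norm of the type \<open>real^'n^'n\<close> is the Frobenius norm,
  see \<open>norm_matrix_eq_trace\<close>.
\<close>

definition xbar :: "real \<Rightarrow> nat \<Rightarrow> (nat \<Rightarrow> real) \<Rightarrow> (nat \<Rightarrow> 'a::real_normed_vector) \<Rightarrow> 'a" where
  "xbar p N w x = (ARG_MIN (\<lambda>z. \<Sum>i=1..N. w i * norm (x i - z) powr p) z. True)"

lemma norm_matrix_eq_trace:
  fixes A :: "real^'n^'n"
  shows "norm A = sqrt (trace (transpose A ** A))"
proof -
  have "(norm A)\<^sup>2 = (\<Sum>k\<in>UNIV. \<Sum>l\<in>UNIV. (A $ k $ l)\<^sup>2)"
    by (simp add: norm_vec_def L2_set_def sum_nonneg)
  also have "\<dots> = (\<Sum>l\<in>UNIV. \<Sum>k\<in>UNIV. (A $ k $ l)\<^sup>2)"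
    by (rule sum.swap)
  also have "\<dots> = trace (transpose A ** A)"
    by (simp add: trace_def matrix_matrix_mult_def transpose_def power2_eq_square)
  finally show ?thesis
    by (metis norm_ge_zero real_sqrt_unique)
qed

definition matrix_spectrum :: "real^'n^'n \<Rightarrow> complex set" where
  "matrix_spectrum A = {z. \<not> invertible (map_matrix complex_of_real A - mat z)}"

definition eigenspace :: "real^'n^'n \<Rightarrow> real \<Rightarrow> (real^'n) set" where
  "eigenspace A c = {x. A *v x = c *\<^sub>R x}"

definition pos_semidef :: "real^'n^'n \<Rightarrow> bool" where
  "pos_semidef A \<longleftrightarrow> (\<forall>x. 0 \<le> x \<bullet> (A *v x))"

end

theory Submission
  imports Defs
begin

text \<open>
  In both cases \<open>S x = xbar A x + xbar v\<close> is the weighted \<open>p\<close>-mean of the points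
  \<open>T\<^sub>i x = A\<^sub>i x + v\<^sub>i\<close>, so the couplings \<open>(T\<^sub>i, S)\<close> bound the barycenter functional at the claimed
  measure from above. The matching lower bound comes from explicit Kantorovich potentials
  \<open>\<phi>\<^sub>i, \<psi>\<^sub>i\<close> with \<open>\<phi>\<^sub>i(x) + \<psi>\<^sub>i(z) \<le> w\<^sub>i \<bar>x - z\<bar>\<^sup>p\<close>, equality along the couplings, and
  \<open>\<Sum>\<^sub>i \<psi>\<^sub>i = 0\<close>, the last being the first-order condition for the weighted mean. For translations
  they are affine (tangents of \<open>\<bar>\<cdot>\<bar>\<^sup>p\<close>). In the second case all matrices have the form
  \<open>A\<^sub>i = (1 - Q) + \<zeta>\<^sub>i Q\<close> with one orthogonal projection \<open>Q\<close>, and the potentials are multiples of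
  \<open>\<bar>Q (x - v)\<bar>\<^sup>p\<close>. For \<open>i = 1\<close> equality in the potential inequality forces \<open>z = R x\<close> for a continuous
  map \<open>R\<close>, so every minimizer is the pushforward of \<open>\<mu>\<^sub>1\<close> under \<open>R\<close>.
\<close>

section \<open>The function \<open>\<bar>\<cdot>\<bar>\<^sup>p\<close> and weighted means\<close>

text \<open>The mean value theorem turns the chord slope into a derivative at an intermediate point,
  and the derivative is strictly increasing. The endpoint \<open>a = 0\<close>, where
  \<open>D\<close> gives no derivative, reduces to \<open>(1 - p) * b powr p < 0\<close>.\<close>

lemma powr_gt_tangent:
  fixes a b p :: real
  assumes "1 < p" "0 \<le> a" "0 < b" "a \<noteq> b"
  shows "b powr p + p * b powr (p - 1) * (a - b) < a powr p"
proof -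
  have D: "((\<lambda>t. t powr p) has_real_derivative p * t powr (p - 1)) (at t)" if "0 < t" for t
    using that by (auto intro!: derivative_eq_intros)
  consider "a = 0" | "b < a" | "0 < a" "a < b" using assms by linarith
  then show ?thesis
  proof cases
    case 1
    have "b powr (p - 1) * b = b powr p" using assms(3) by (simp add: powr_diff)
    moreover have "(1 - p) * b powr p < 0" using assms by (simp add: mult_neg_pos)
    ultimately show ?thesis using 1 assms by (simp add: algebra_simps)
  next
    case 2
    obtain z where z: "b < z" "z < a" "a powr p - b powr p = (a - b) * (p * z powr (p - 1))"
      using MVT2[of b a "\<lambda>t. t powr p" "\<lambda>t. p * t powr (p - 1)"] 2 D assms by force
    have "b powr (p - 1) < z powr (p - 1)" using z assms by (intro powr_less_mono2) auto
    then have "(a - b) * (p * b powr (p - 1)) < (a - b) * (p * z powr (p - 1))"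
      using 2 assms by (intro mult_strict_left_mono) auto
    with z show ?thesis by (simp add: algebra_simps)
  next
    case 3
    obtain z where z: "a < z" "z < b" "b powr p - a powr p = (b - a) * (p * z powr (p - 1))"
      using MVT2[of a b "\<lambda>t. t powr p" "\<lambda>t. p * t powr (p - 1)"] 3 D assms by force
    have "z powr (p - 1) < b powr (p - 1)" using z 3 assms by (intro powr_less_mono2) auto
    then have "(b - a) * (p * z powr (p - 1)) < (b - a) * (p * b powr (p - 1))"
      using 3 assms by (intro mult_strict_left_mono) auto
    with z show ?thesis by (simp add: algebra_simps)
  qed
qed

text \<open>The gradient of \<open>norm h powr p\<close>. At \<open>h = 0\<close> the vector factor
  gives \<open>0\<close>, the right value for every \<open>p > 1\<close>, even though
  \<open>norm h powr (p - 2)\<close> blows up nearby when \<open>p < 2\<close>.\<close>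

definition norm_powr_grad :: "real \<Rightarrow> 'a::real_inner \<Rightarrow> 'a" where
  "norm_powr_grad p h = (p * norm h powr (p - 2)) *\<^sub>R h"

lemma norm_powr_grad_0 [simp]: "norm_powr_grad p 0 = 0"
  by (simp add: norm_powr_grad_def)

lemma norm_norm_powr_grad:
  assumes "0 \<le> p"
  shows "norm (norm_powr_grad p h) = p * norm h powr (p - 1)"
proof (cases "h = 0")
  case False
  then have "norm h powr (p - 2) * norm h = norm h powr (p - 1)"
    using powr_add[of "norm h" "p - 2" 1] by simp
  then show ?thesis using assms by (simp add: norm_powr_grad_def)
qed simp

lemma isCont_norm_powr_grad:
  assumes "1 < p"
  shows "isCont (norm_powr_grad p) h"
proof (cases "h = 0")
  \<comment> \<open>For \<open>p < 2\<close> the scalar factor is unbounded near \<open>0\<close>,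
    so continuity there is read off from the norm \<open>p * norm h powr (p - 1)\<close>.\<close>
  case True
  have "((\<lambda>h::'a. norm h powr (p - 1)) \<longlongrightarrow> 0 powr (p - 1)) (at 0)"
    using assms by (intro tendsto_powr' tendsto_const tendsto_norm_zero tendsto_ident_at) auto
  then have "((\<lambda>h::'a. p * norm h powr (p - 1)) \<longlongrightarrow> p * 0) (at 0)"
    by (intro tendsto_intros) simp
  then have "((\<lambda>h::'a. norm (norm_powr_grad p h)) \<longlongrightarrow> 0) (at 0)"
    using assms by (simp add: norm_norm_powr_grad)
  then show ?thesis
    by (simp add: True isCont_def tendsto_norm_zero_iff)
next
  case False
  then show ?thesis
    unfolding norm_powr_grad_def by (intro continuous_intros) auto
qed

text \<open>Cauchy-Schwarz reduces this to the scalar tangent inequality for \<open>norm y\<close>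
  against \<open>norm h\<close>. If the two norms agree, the scalar inequality is an equality and
  strictness comes from strict Cauchy-Schwarz instead.\<close>

lemma norm_powr_gt_tangent:
  fixes y h :: "'a::real_inner"
  assumes "1 < p" "y \<noteq> h"
  shows "norm h powr p + norm_powr_grad p h \<bullet> (y - h) < norm y powr p"
proof (cases "h = 0")
  case True
  then show ?thesis using assms by simp
next
  case False
  define b where "b = norm h"
  have b: "0 < b" using False by (simp add: b_def)
  have p1: "b powr (p - 2) * b = b powr (p - 1)" 
    using b powr_add[of b "p - 2" 1] by simp
  have G: "norm_powr_grad p h \<bullet> (y - h) = p * b powr (p - 2) * (h \<bullet> y - b * b)"
    by (simp add: norm_powr_grad_def b_def inner_diff_right dot_square_norm power2_eq_square right_diff_distrib)
  have p2: "0 < p * b powr (p - 2)" using assms b by simp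
  have e: "p * b powr (p - 2) * (b * norm y - b * b) = p * b powr (p - 1) * (norm y - b)"
    using p1 by (simp add: algebra_simps flip: p1)
  show ?thesis
  proof (cases "norm y = b")
    case True
    have "h \<bullet> y \<noteq> norm h * norm y"
      using assms True b unfolding norm_cauchy_schwarz_eq b_def by auto
    then have "h \<bullet> y < b * b"
      using norm_cauchy_schwarz[of h y] True by (simp add: b_def)
    then have "p * b powr (p - 2) * (h \<bullet> y - b * b) < 0"
      using p2 by (simp add: mult_pos_neg)
    then show ?thesis using G True by (simp add: b_def)
  next
    case False
    have "p * b powr (p - 2) * (h \<bullet> y - b * b) \<le> p * b powr (p - 2) * (b * norm y - b * b)"
      using norm_cauchy_schwarz[of h y] p2 by (intro mult_left_mono) (auto simp: b_def)
    moreover have "b powr p + p * b powr (p - 1) * (norm y - b) < norm y powr p"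
      using powr_gt_tangent[of p "norm y" b] False assms b by simp
    ultimately show ?thesis using G e unfolding b_def by linarith
  qed
qed

lemma norm_powr_ge_tangent:
  fixes y h :: "'a::real_inner"
  assumes "1 < p"
  shows "norm h powr p + norm_powr_grad p h \<bullet> (y - h) \<le> norm y powr p"
  using norm_powr_gt_tangent[OF assms, of y h] by (cases "y = h") auto

text \<open>The perspective \<open>(\<alpha>, x) \<mapsto> \<alpha> \<bar>x / \<alpha>\<bar>\<^sup>p\<close> of the strictly convex function
  \<open>\<bar>\<cdot>\<bar>\<^sup>p\<close> is subadditive, strictly off the common rays.\<close>

lemma norm_powr_perspective_add_less:
  fixes x y :: "'a::real_inner"
  assumes "1 < p" "0 < \<alpha>" "0 < \<beta>" "\<beta> *\<^sub>R x \<noteq> \<alpha> *\<^sub>R y"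
  shows "(\<alpha> + \<beta>) powr (1 - p) * norm (x + y) powr p
       < \<alpha> powr (1 - p) * norm x powr p + \<beta> powr (1 - p) * norm y powr p"
proof -
  \<comment> \<open>The mean of \<open>x / \<alpha>\<close> and \<open>y / \<beta>\<close> with
    weights proportional to \<open>\<alpha>\<close> and \<open>\<beta>\<close>. The tangent at
    \<open>m\<close> is used at both points, and the linear terms cancel in the weighted
    sum.\<close>
  define m where "m = (1 / (\<alpha> + \<beta>)) *\<^sub>R (x + y)"
  have scale: "c * norm ((1 / c) *\<^sub>R u) powr p = c powr (1 - p) * norm u powr p"
    if "0 < c" for c and u :: 'a
  proof -
    have "c * norm ((1 / c) *\<^sub>R u) powr p = c * (norm u powr p / c powr p)"
      using that by (simp add: powr_divide)
    also have "\<dots> = c powr (1 - p) * norm u powr p"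
      using that by (simp add: powr_diff)
    finally show ?thesis .
  qed
  have ne: "(1 / \<alpha>) *\<^sub>R x \<noteq> m"
  proof
    assume "(1 / \<alpha>) *\<^sub>R x = m"
    then have "(\<alpha> * (\<alpha> + \<beta>)) *\<^sub>R ((1 / \<alpha>) *\<^sub>R x) = (\<alpha> * (\<alpha> + \<beta>)) *\<^sub>R m" by simp
    then have "(\<alpha> + \<beta>) *\<^sub>R x = \<alpha> *\<^sub>R (x + y)"
      using assms by (simp add: m_def)
    then show False using assms by (simp add: algebra_simps)
  qed
  have "\<alpha> * (norm m powr p + norm_powr_grad p m \<bullet> ((1 / \<alpha>) *\<^sub>R x - m))
      < \<alpha> * norm ((1 / \<alpha>) *\<^sub>R x) powr p"
    using norm_powr_gt_tangent[OF assms(1) ne] assms by simp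
  moreover have "\<beta> * (norm m powr p + norm_powr_grad p m \<bullet> ((1 / \<beta>) *\<^sub>R y - m))
      \<le> \<beta> * norm ((1 / \<beta>) *\<^sub>R y) powr p"
    using assms by (intro mult_left_mono norm_powr_ge_tangent) auto
  moreover have "\<alpha> * (norm_powr_grad p m \<bullet> ((1 / \<alpha>) *\<^sub>R x - m)) + \<beta> * (norm_powr_grad p m \<bullet> ((1 / \<beta>) *\<^sub>R y - m)) = 0"
  proof -
    have "\<alpha> * (norm_powr_grad p m \<bullet> ((1 / \<alpha>) *\<^sub>R x - m)) + \<beta> * (norm_powr_grad p m \<bullet> ((1 / \<beta>) *\<^sub>R y - m))
      = norm_powr_grad p m \<bullet> (x + y - (\<alpha> + \<beta>) *\<^sub>R m)"
      using assms by (simp add: inner_diff_right inner_add_right algebra_simps)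
    then show ?thesis using assms by (simp add: m_def)
  qed
  ultimately have "(\<alpha> + \<beta>) * norm m powr p < \<alpha> * norm ((1 / \<alpha>) *\<^sub>R x) powr p + \<beta> * norm ((1 / \<beta>) *\<^sub>R y) powr p"
    by (simp add: algebra_simps)
  then show ?thesis using assms unfolding m_def by (simp only: scale add_pos_pos)
qed

text \<open>Both vectors are multiples of one \<open>u\<close>, and along the pairs
  \<open>(c, c u)\<close> the perspective equals \<open>c * norm u powr p\<close>, which is linear
  in \<open>c\<close>.\<close>

lemma norm_powr_perspective_add_eq:
  fixes x y :: "'a::real_inner"
  assumes "1 < p" "0 < \<alpha>" "0 < \<beta>" "\<beta> *\<^sub>R x = \<alpha> *\<^sub>R y"
  shows "(\<alpha> + \<beta>) powr (1 - p) * norm (x + y) powr p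
       = \<alpha> powr (1 - p) * norm x powr p + \<beta> powr (1 - p) * norm y powr p"
proof -
  define u where "u = (1 / \<alpha>) *\<^sub>R x"
  have x: "x = \<alpha> *\<^sub>R u" using assms by (simp add: u_def)
  have "\<alpha> *\<^sub>R y = \<alpha> *\<^sub>R (\<beta> *\<^sub>R u)" using assms(4) by (simp add: x mult.commute)
  then have y: "y = \<beta> *\<^sub>R u" using assms(2) by (simp del: scaleR_scaleR)
  have "norm (\<alpha> *\<^sub>R u + \<beta> *\<^sub>R u) = (\<alpha> + \<beta>) * norm u"
    using assms(2,3) by (subst scaleR_left_distrib[symmetric]) simp
  moreover have "c powr (1 - p) * (c * norm u) powr p = c * norm u powr p" if "0 < c" for c
    using that by (simp add: powr_mult powr_diff)
  ultimately show ?thesis using assms(2,3)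
    by (simp add: x y distrib_right[of _ _ "norm u powr p"] del: distrib_right_numeral)
qed

section \<open>First-order characterization of weighted means\<close>

text \<open>By convexity a critical point suffices: the tangent inequalities at \<open>b\<close> are
  summed, \<open>crit\<close> removes the linear terms, and strictness makes \<open>b\<close> the
  only minimizer, so \<open>ARG_MIN\<close> must return it.\<close>

lemma xbar_eqI:
  fixes x :: "nat \<Rightarrow> 'a::real_inner"
  assumes p: "1 < p" and w: "\<And>i. i \<in> {1..N} \<Longrightarrow> 0 < w i" and N: "1 \<le> N"
    and crit: "(\<Sum>i=1..N. w i *\<^sub>R norm_powr_grad p (x i - b)) = 0"
  shows "xbar p N w x = b"
proof -
  define f where "f = (\<lambda>z. \<Sum>i=1..N. w i * norm (x i - z) powr p)"
  have less: "f b < f z" if "z \<noteq> b" for z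
  proof -
    have "f b = (\<Sum>i=1..N. w i * norm (x i - b) powr p)
        + (\<Sum>i=1..N. w i *\<^sub>R norm_powr_grad p (x i - b)) \<bullet> (b - z)"
      by (simp only: f_def crit inner_zero_left add_0_right)
    also have "\<dots> = (\<Sum>i=1..N. w i * (norm (x i - b) powr p
        + norm_powr_grad p (x i - b) \<bullet> ((x i - z) - (x i - b))))"
      by (simp add: inner_sum_left sum.distrib distrib_left)
    also have "\<dots> < f z"
      unfolding f_def using that w N
      by (intro sum_strict_mono mult_strict_left_mono norm_powr_gt_tangent p) auto
    finally show ?thesis .
  qed
  have "is_arg_min f (\<lambda>_. True) b"
    using less by (metis is_arg_min_def order.asym)
  then have "is_arg_min f (\<lambda>_. True) (arg_min f (\<lambda>_. True))"
    unfolding arg_min_def by (rule someI)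
  then have "arg_min f (\<lambda>_. True) = b"
    using less by (auto simp: is_arg_min_def)
  then show ?thesis by (simp add: xbar_def f_def)
qed

text \<open>Converse to \<open>xbar_eqI\<close>: a minimizer exists by coercivity and satisfies the
  first-order condition. This condition is what later makes the potentials \<open>\<psi>\<close> sum
  to zero.\<close>

lemma xbar_critical:
  fixes x :: "nat \<Rightarrow> 'a::euclidean_space"
  assumes p: "1 < p" and w: "\<And>i. i \<in> {1..N} \<Longrightarrow> 0 < w i" and N: "1 \<le> N"
  shows "(\<Sum>i=1..N. w i *\<^sub>R norm_powr_grad p (x i - xbar p N w x)) = 0"
proof -
  define f where "f = (\<lambda>z. \<Sum>i=1..N. w i * norm (x i - z) powr p)"
  have wN: "0 < w 1" using w N by simp
  have f1: "w 1 * norm (x 1 - z) powr p \<le> f z" for z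
    unfolding f_def using w N
    by (intro member_le_sum[of 1 "{1..N}" "\<lambda>i. w i * norm (x i - z) powr p"])
       (auto intro!: mult_nonneg_nonneg less_imp_le[OF w])
  \<comment> \<open>Chosen so that \<open>w 1 * r powr p = f (x 1)\<close>. Outside the ball the
    first summand alone exceeds \<open>f (x 1)\<close>, so the minimum over the ball is
    global.\<close>
  define r where "r = (f (x 1) / w 1) powr (1 / p)"
  have f0: "0 \<le> f (x 1)" using f1[of "x 1"] by simp
  have rp: "r powr p = f (x 1) / w 1" using p f0 wN by (simp add: r_def powr_powr)
  have "continuous_on (cball (x 1) r) f"
    unfolding f_def using p by (intro continuous_intros continuous_on_powr') auto
  moreover have "x 1 \<in> cball (x 1) r" by (simp add: r_def)
  ultimately obtain b where b: "\<forall>z\<in>cball (x 1) r. f b \<le> f z"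
    using continuous_attains_inf[of "cball (x 1) r" f] by auto
  have min: "f b \<le> f z" for z
  proof (cases "z \<in> cball (x 1) r")
    case False
    then have "r < norm (x 1 - z)" by (simp add: dist_norm)
    then have "r powr p < norm (x 1 - z) powr p"
      using p by (intro powr_less_mono2) (auto simp: r_def)
    then have "f (x 1) < w 1 * norm (x 1 - z) powr p"
      using wN by (simp add: rp field_simps)
    with b \<open>x 1 \<in> cball (x 1) r\<close> have "f b \<le> f (x 1)" by blast
    with f1[of z] \<open>f (x 1) < _\<close> show ?thesis by linarith
  qed (use b in auto)
  define g where "g = (\<lambda>h. \<Sum>i=1..N. w i *\<^sub>R norm_powr_grad p (x i - b + h))"
  \<comment> \<open>The tangent inequality at the displaced point bounds the increment of \<open>f\<close> from above by
    a quantity continuous in the displacement, so no derivative is needed.\<close>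
  have gt: "0 \<le> g (t *\<^sub>R e) \<bullet> e" if "0 < t" for t e
  proof -
    have "f (b - t *\<^sub>R e) - f b = (\<Sum>i=1..N. w i * (norm (x i - b + t *\<^sub>R e) powr p - norm (x i - b) powr p))"
      by (simp add: f_def sum_subtractf algebra_simps)
    also have "\<dots> \<le> (\<Sum>i=1..N. w i * (norm_powr_grad p (x i - b + t *\<^sub>R e) \<bullet> (t *\<^sub>R e)))"
    proof (intro sum_mono mult_left_mono)
      fix i assume i: "i \<in> {1..N}"
      show "norm (x i - b + t *\<^sub>R e) powr p - norm (x i - b) powr p
          \<le> norm_powr_grad p (x i - b + t *\<^sub>R e) \<bullet> (t *\<^sub>R e)"
        using norm_powr_ge_tangent[OF p, of "x i - b + t *\<^sub>R e" "x i - b"] by simp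
    qed (use w less_imp_le in auto)
    also have "\<dots> = t * (g (t *\<^sub>R e) \<bullet> e)"
      by (simp add: g_def inner_sum_left sum_distrib_left mult_ac)
    finally have "0 \<le> t * (g (t *\<^sub>R e) \<bullet> e)" using min[of "b - t *\<^sub>R e"] by linarith
    with that show ?thesis by (simp add: zero_le_mult_iff)
  qed
  have "0 \<le> g 0 \<bullet> e" for e
  proof -
    have cont: "isCont (\<lambda>t::real. norm_powr_grad p (x i - b + t *\<^sub>R e)) 0" for i
      by (rule isCont_o2[OF _ isCont_norm_powr_grad[OF p]]) (intro continuous_intros)
    have "isCont (\<lambda>t::real. g (t *\<^sub>R e) \<bullet> e) 0"
      unfolding g_def by (intro continuous_intros cont)
    then have "((\<lambda>t. g (t *\<^sub>R e) \<bullet> e) \<longlongrightarrow> g 0 \<bullet> e) (at_right 0)"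
      by (auto simp: isCont_def intro: filterlim_mono at_le)
    then show ?thesis
      by (rule tendsto_lowerbound)
         (auto simp: eventually_at_filter gt)
  qed
  \<comment> \<open>In the direction \<open>- g 0\<close> the bound says that minus the squared norm
    of \<open>g 0\<close> is nonnegative.\<close>
  from this[of "- g 0"] have g0: "g 0 = 0" 
    by (metis inner_eq_zero_iff inner_ge_zero inner_minus_right neg_0_le_iff_le order_antisym)
  then have "xbar p N w x = b"
    using p w N by (intro xbar_eqI) (simp_all add: g_def)
  with g0 show ?thesis by (simp add: g_def)
qed

section \<open>Transport plans and duality\<close>

lemma transport_planD:
  assumes "\<pi> \<in> transport_plans \<mu> \<nu>"
  shows "sets \<pi> = sets borel" "space \<pi> = UNIV" "fst \<in> \<pi> \<rightarrow>\<^sub>M borel" "snd \<in> \<pi> \<rightarrow>\<^sub>M borel"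
    "distr \<pi> borel fst = \<mu>" "distr \<pi> borel snd = \<nu>"
proof -
  show s: "sets \<pi> = sets borel" and "distr \<pi> borel fst = \<mu>" "distr \<pi> borel snd = \<nu>"
    using assms by (auto simp: transport_plans_def)
  show "space \<pi> = UNIV" using sets_eq_imp_space_eq[OF s] by simp
  show "fst \<in> \<pi> \<rightarrow>\<^sub>M borel" "snd \<in> \<pi> \<rightarrow>\<^sub>M borel"
    by (simp_all add: measurable_cong_sets[OF s refl] borel_measurable_continuous_onI continuous_intros)
qed

lemma transport_plan_integral:
  fixes f g :: "'a::euclidean_space \<Rightarrow> real"
  assumes \<pi>: "\<pi> \<in> transport_plans \<mu> \<nu>"
  shows "integrable \<mu> f \<Longrightarrow> integrable \<pi> (\<lambda>z. f (fst z))"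
    "integrable \<nu> g \<Longrightarrow> integrable \<pi> (\<lambda>z. g (snd z))"
    "integrable \<mu> f \<Longrightarrow> (\<integral>z. f (fst z) \<partial>\<pi>) = integral\<^sup>L \<mu> f"
    "integrable \<nu> g \<Longrightarrow> (\<integral>z. g (snd z) \<partial>\<pi>) = integral\<^sup>L \<nu> g"
  using transport_planD[OF \<pi>] 
  by (auto intro: integrable_distr) (metis integral_distr borel_measurable_integrable measurable_distr_eq1)+

section \<open>Moments and integrability of transport costs\<close>

lemma norm_diff_powr_le:
  fixes x y :: "'a::real_normed_vector"
  assumes "0 \<le> p"
  shows "norm (x - y) powr p \<le> 2 powr p * (norm x powr p + norm y powr p)"
proof -
  have "norm (x - y) powr p \<le> (2 * max (norm x) (norm y)) powr p"
    using norm_triangle_ineq4[of x y] assms by (intro powr_mono2) auto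
  also have "\<dots> = 2 powr p * max (norm x) (norm y) powr p"
    by (simp add: powr_mult)
  also have "max (norm x) (norm y) powr p \<le> norm x powr p + norm y powr p"
    by (simp add: max_def)
  finally show ?thesis by simp
qed

lemma prob_measures_pD:
  assumes "\<mu> \<in> prob_measures_p p"
  shows "prob_space \<mu>" "sets \<mu> = sets borel" "space \<mu> = UNIV" "integrable \<mu> (\<lambda>x. norm x powr p)"
  using assms sets_eq_imp_space_eq[of \<mu> borel] by (auto simp: prob_measures_p_def)

lemma integrable_of_powr_growth:
  fixes f :: "'a::euclidean_space \<Rightarrow> real"
  assumes \<mu>: "\<mu> \<in> prob_measures_p p" and f: "continuous_on UNIV f"
    and le: "\<And>x. \<bar>f x\<bar> \<le> C * (1 + norm x powr p)"
  shows "integrable \<mu> f"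
proof -
  interpret prob_space \<mu> using prob_measures_pD[OF \<mu>] by simp
  have "integrable \<mu> (\<lambda>x. C * (1 + norm x powr p))"
    using prob_measures_pD[OF \<mu>] by (intro integrable_mult_right integrable_add) auto
  moreover have "f \<in> borel_measurable \<mu>"
    using f by (simp add: measurable_cong_sets[OF prob_measures_pD(2)[OF \<mu>] refl] borel_measurable_continuous_onI)
  ultimately show ?thesis
    by (rule Bochner_Integration.integrable_bound) (use le in \<open>auto intro!: AE_I2 order_trans[OF le]\<close>)
qed

lemma integrable_transport_cost:
  assumes p: "0 \<le> p" and \<mu>: "\<mu> \<in> prob_measures_p p" and \<nu>: "\<nu> \<in> prob_measures_p p"
    and \<pi>: "\<pi> \<in> transport_plans \<mu> \<nu>"
  shows "integrable \<pi> (\<lambda>z. dist (fst z) (snd z) powr p)"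
proof -
  have "integrable \<pi> (\<lambda>z. 2 powr p * (norm (fst z) powr p + norm (snd z) powr p))"
    using transport_plan_integral(1)[OF \<pi> prob_measures_pD(4)[OF \<mu>]]
      transport_plan_integral(2)[OF \<pi> prob_measures_pD(4)[OF \<nu>]]
    by (intro integrable_mult_right Bochner_Integration.integrable_add)
  moreover have "(\<lambda>z. dist (fst z) (snd z) powr p) \<in> borel_measurable \<pi>"
    using transport_planD(3,4)[OF \<pi>] by measurable
  ultimately show ?thesis
    by (rule Bochner_Integration.integrable_bound)
       (auto intro!: AE_I2 order_trans[OF norm_diff_powr_le[OF p]] simp: dist_norm)
qed

text \<open>Supplies the nonemptiness of the set of plans, on which the later manipulations of real
  infima rest.\<close>

lemma pair_measure_in_transport_plans:
  assumes \<mu>: "\<mu> \<in> prob_measures_p p" and \<nu>: "\<nu> \<in> prob_measures_p p"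
  shows "\<mu> \<Otimes>\<^sub>M \<nu> \<in> transport_plans \<mu> \<nu>"
proof -
  interpret \<mu>: prob_space \<mu> using prob_measures_pD[OF \<mu>] by simp
  interpret \<nu>: prob_space \<nu> using prob_measures_pD[OF \<nu>] by simp
  interpret pair_prob_space \<mu> \<nu> ..
  note s = prob_measures_pD(2)[OF \<mu>] prob_measures_pD(2)[OF \<nu>]
  have "distr (\<mu> \<Otimes>\<^sub>M \<nu>) borel fst = distr (\<mu> \<Otimes>\<^sub>M \<nu>) \<mu> fst"
    "distr (\<mu> \<Otimes>\<^sub>M \<nu>) borel snd = distr (\<mu> \<Otimes>\<^sub>M \<nu>) \<nu> snd"
    by (intro distr_cong refl, simp add: s)+
  moreover have "distr (\<mu> \<Otimes>\<^sub>M \<nu>) \<mu> fst = \<mu>" by (rule \<nu>.distr_pair_fst)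
  moreover have "distr (\<mu> \<Otimes>\<^sub>M \<nu>) \<nu> snd = \<nu>" 
  proof (rule measure_eqI)
    fix B assume "B \<in> sets (distr (\<mu> \<Otimes>\<^sub>M \<nu>) \<nu> snd)"
    then have B: "B \<in> sets \<nu>" by simp
    then have "snd -` B \<inter> space (\<mu> \<Otimes>\<^sub>M \<nu>) = space \<mu> \<times> B"
      using sets.sets_into_space by (auto simp: space_pair_measure)
    with B show "emeasure (distr (\<mu> \<Otimes>\<^sub>M \<nu>) \<nu> snd) B = emeasure \<nu> B"
      by (simp add: emeasure_distr \<nu>.emeasure_pair_measure_Times \<mu>.emeasure_space_1)
  qed simp
  moreover have "sets (\<mu> \<Otimes>\<^sub>M \<nu>) = sets borel"
    using sets_pair_measure_cong[OF s] by (simp only: borel_prod)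
  ultimately show ?thesis by (simp add: transport_plans_def)
qed

section \<open>The distance as a real infimum over plans\<close>

lemma bdd_below_transport_cost:
  "bdd_below ((\<lambda>\<pi>. \<integral>z. dist (fst z) (snd z) powr p \<partial>\<pi>) ` transport_plans \<mu> \<nu>)"
  by (rule bdd_belowI[of _ 0]) (auto intro!: integral_nonneg)

text \<open>Finite moments make every plan's cost finite, so the extended infimum may be replaced by
  one of Bochner integrals. The three lemmas that follow are its upper bound, lower bound and
  approximation forms.\<close>

lemma wasserstein_dist_powr_eq:
  assumes p: "0 < p" and \<mu>: "\<mu> \<in> prob_measures_p p" and \<nu>: "\<nu> \<in> prob_measures_p p"
  shows "wasserstein_dist p \<mu> \<nu> powr p = (INF \<pi>\<in>transport_plans \<mu> \<nu>. \<integral>z. dist (fst z) (snd z) powr p \<partial>\<pi>)"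
proof -
  let ?c = "\<lambda>\<pi>. \<integral>z. dist (fst z) (snd z) powr p \<partial>\<pi>"
  have ne: "transport_plans \<mu> \<nu> \<noteq> {}"
    using pair_measure_in_transport_plans[OF \<mu> \<nu>] by auto
  have "(\<integral>\<^sup>+ z. ennreal (dist (fst z) (snd z) powr p) \<partial>\<pi>) = ennreal (?c \<pi>)"
    if "\<pi> \<in> transport_plans \<mu> \<nu>" for \<pi>
    using p by (intro nn_integral_eq_integral integrable_transport_cost[OF _ \<mu> \<nu> that]) auto
  then have "(INF \<pi>\<in>transport_plans \<mu> \<nu>. \<integral>\<^sup>+ z. ennreal (dist (fst z) (snd z) powr p) \<partial>\<pi>)
    = (INF \<pi>\<in>transport_plans \<mu> \<nu>. ennreal (?c \<pi>))"
    by (intro INF_cong) auto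
  also have "\<dots> = ennreal (INF \<pi>\<in>transport_plans \<mu> \<nu>. ?c \<pi>)"
  proof (rule antisym)
    \<comment> \<open>The direction with content: a plan within \<open>e\<close> of the real infimum
      bounds the extended one.\<close>
    show "(INF \<pi>\<in>transport_plans \<mu> \<nu>. ennreal (?c \<pi>)) \<le> ennreal (INF \<pi>\<in>transport_plans \<mu> \<nu>. ?c \<pi>)"
    proof (rule ennreal_le_epsilon)
      fix e :: real assume "0 < e"
      then have "(INF \<pi>\<in>transport_plans \<mu> \<nu>. ?c \<pi>) < (INF \<pi>\<in>transport_plans \<mu> \<nu>. ?c \<pi>) + e" by simp
      then obtain \<pi> where \<pi>: "\<pi> \<in> transport_plans \<mu> \<nu>"
        "?c \<pi> < (INF \<pi>\<in>transport_plans \<mu> \<nu>. ?c \<pi>) + e"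
        by (subst (asm) cINF_less_iff[OF ne bdd_below_transport_cost]) auto
      have "(INF \<pi>\<in>transport_plans \<mu> \<nu>. ennreal (?c \<pi>)) \<le> ennreal (?c \<pi>)"
        using \<pi> by (intro INF_lower)
      also have "\<dots> \<le> ennreal ((INF \<pi>\<in>transport_plans \<mu> \<nu>. ?c \<pi>) + e)"
        using \<pi> by (intro ennreal_leI) simp
      also have "\<dots> = ennreal (INF \<pi>\<in>transport_plans \<mu> \<nu>. ?c \<pi>) + ennreal e"
        using ne \<open>0 < e\<close> by (intro ennreal_plus cINF_greatest) (auto intro!: integral_nonneg)
      finally show "(INF \<pi>\<in>transport_plans \<mu> \<nu>. ennreal (?c \<pi>)) \<le> \<dots>" .
    qed
  qed (auto intro!: INF_greatest ennreal_leI cINF_lower bdd_below_transport_cost)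
  finally have "wasserstein_dist p \<mu> \<nu> = (INF \<pi>\<in>transport_plans \<mu> \<nu>. ?c \<pi>) powr (1 / p)"
    using ne by (simp add: wasserstein_dist_def cINF_greatest integral_nonneg)
  then show ?thesis
    using p ne by (simp add: powr_powr cINF_greatest integral_nonneg)
qed

lemma wasserstein_dist_powr_le:
  assumes "0 < p" "\<mu> \<in> prob_measures_p p" "\<nu> \<in> prob_measures_p p" "\<pi> \<in> transport_plans \<mu> \<nu>"
  shows "wasserstein_dist p \<mu> \<nu> powr p \<le> (\<integral>z. dist (fst z) (snd z) powr p \<partial>\<pi>)"
  using cINF_lower[OF bdd_below_transport_cost assms(4)] assms
  by (simp add: wasserstein_dist_powr_eq)

lemma wasserstein_dist_powr_ge:
  assumes "0 < p" "\<mu> \<in> prob_measures_p p" "\<nu> \<in> prob_measures_p p"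
    and "\<And>\<pi>. \<pi> \<in> transport_plans \<mu> \<nu> \<Longrightarrow> c \<le> (\<integral>z. dist (fst z) (snd z) powr p \<partial>\<pi>)"
  shows "c \<le> wasserstein_dist p \<mu> \<nu> powr p"
  using assms pair_measure_in_transport_plans[OF assms(2,3)]
  by (auto simp: wasserstein_dist_powr_eq intro!: cINF_greatest)

lemma wasserstein_dist_powr_approx:
  assumes "0 < p" "\<mu> \<in> prob_measures_p p" "\<nu> \<in> prob_measures_p p" "0 < e"
  obtains \<pi> where "\<pi> \<in> transport_plans \<mu> \<nu>"
    "(\<integral>z. dist (fst z) (snd z) powr p \<partial>\<pi>) < wasserstein_dist p \<mu> \<nu> powr p + e"
proof -
  have "(INF \<pi>\<in>transport_plans \<mu> \<nu>. \<integral>z. dist (fst z) (snd z) powr p \<partial>\<pi>) < wasserstein_dist p \<mu> \<nu> powr p + e"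
    using assms by (simp add: wasserstein_dist_powr_eq)
  then show ?thesis
    using that pair_measure_in_transport_plans[OF assms(2,3)]
    by (subst (asm) cINF_less_iff[OF _ bdd_below_transport_cost]) auto
qed

text \<open>Outer regularity of the pushforward makes it enough to compare a compact \<open>K\<close> with an open
  \<open>U \<supseteq> K\<close>: away from the graph of \<open>R\<close>, on bounded sets, the defect \<open>D\<close> is bounded below, so plans
  with small total defect give little mass to pairs with \<open>z \<in> K\<close> and \<open>R x \<notin> U\<close>.\<close>

lemma distr_eq_of_vanishing_defect:
  fixes D :: "'a::euclidean_space \<times> 'a \<Rightarrow> real"
  assumes \<mu>: "prob_space \<mu>" "sets \<mu> = sets borel" and \<nu>: "prob_space \<nu>" "sets \<nu> = sets borel"
    and D: "continuous_on UNIV D" "\<And>z. 0 \<le> D z" "\<And>x z. D (x, z) = 0 \<Longrightarrow> z = R x"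
    and R: "continuous_on UNIV R"
    and approx: "\<And>e. 0 < e \<Longrightarrow> \<exists>\<pi>\<in>transport_plans \<mu> \<nu>. integrable \<pi> D \<and> integral\<^sup>L \<pi> D < e"
  shows "\<nu> = distr \<mu> borel R"
proof -
  interpret \<mu>: prob_space \<mu> by fact
  interpret \<nu>: prob_space \<nu> by fact
  have R_meas [measurable]: "R \<in> \<mu> \<rightarrow>\<^sub>M borel"
    using R by (simp add: measurable_cong_sets[OF \<mu>(2) refl] borel_measurable_continuous_onI)
  let ?\<rho> = "distr \<mu> borel R"
  interpret \<rho>: prob_space ?\<rho> by (rule \<mu>.prob_space_distr) simp
  have space: "space \<mu> = UNIV" "space \<nu> = UNIV"
    using sets_eq_imp_space_eq[OF \<mu>(2)] sets_eq_imp_space_eq[OF \<nu>(2)] by simp_all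
  have KU: "measure \<nu> K \<le> measure ?\<rho> U" if K: "compact K" and U: "open U" and "K \<subseteq> U" for K U
  proof (rule field_le_epsilon)
    fix e :: real assume "0 < e"
    define h where "h = e / 2"
    have "0 < h" using \<open>0 < e\<close> by (simp add: h_def)
    \<comment> \<open>Tightness of the single measure \<open>\<mu>\<close>: some ball carries all
      but \<open>h\<close> of its mass.\<close>
    have "(\<lambda>n. measure \<mu> (cball 0 (real n))) \<longlonglongrightarrow> measure \<mu> (\<Union>n. cball 0 (real n))"
    proof (rule \<mu>.finite_Lim_measure_incseq)
      show "range (\<lambda>n. cball 0 (real n)) \<subseteq> sets \<mu>" unfolding \<mu>(2) by auto
      show "incseq (\<lambda>n. cball (0::'a) (real n))" unfolding incseq_def by (simp add: subset_cball)
    qed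
    moreover have "(\<Union>n. cball 0 (real n)) = (UNIV :: 'a set)"
      by (simp add: set_eq_iff real_arch_simple)
    ultimately have "(\<lambda>n. measure \<mu> (cball 0 (real n))) \<longlonglongrightarrow> 1"
      using \<mu>.prob_space by (simp add: space)
    then have "eventually (\<lambda>n. 1 - h < measure \<mu> (cball 0 (real n))) sequentially"
      using \<open>0 < h\<close> by (intro order_tendstoD) auto
    then obtain r :: real where r: "1 - h < measure \<mu> (cball 0 r)"
      by (auto simp: eventually_sequentially)
    \<comment> \<open>The bad pairs over the ball: second point in \<open>K\<close>, but
      \<open>R\<close> sends the first point outside \<open>U\<close>. A zero of \<open>D\<close> in
      \<open>C\<close> would put \<open>R x = z\<close> into \<open>K\<close>, hence into
      \<open>U\<close>; so \<open>D\<close> has a positive minimum on the compact set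
      \<open>C\<close>.\<close>
    define C where "C = (cball 0 r \<times> K) \<inter> (\<lambda>z. R (fst z)) -` (- U)"
    have contR: "continuous_on UNIV (\<lambda>z::'a\<times>'a. R (fst z))"
      by (rule continuous_on_compose2[OF R]) (auto intro: continuous_intros)
    have "closed ((\<lambda>z::'a\<times>'a. R (fst z)) -` (- U))"
      using U contR by (intro closed_vimage) auto
    then have C: "compact C"
      unfolding C_def using K by (intro compact_Int_closed compact_Times) auto
    obtain m where m: "0 < m" "\<And>z. z \<in> C \<Longrightarrow> m \<le> D z"
    proof (cases "C = {}")
      case False
      then obtain c where c: "c \<in> C" "\<forall>z\<in>C. D c \<le> D z"
        using continuous_attains_inf[OF C, of D] D(1) continuous_on_subset by blast
      have "D c \<noteq> 0" using c(1) D(3)[of "fst c" "snd c"] \<open>K \<subseteq> U\<close> by (auto simp: C_def)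
      then show ?thesis using that[of "D c"] c(2) D(2)[of c] by auto
    qed (use that[of 1] in auto)
    obtain \<pi> where \<pi>: "\<pi> \<in> transport_plans \<mu> \<nu>" and int: "integrable \<pi> D" "integral\<^sup>L \<pi> D < m * h"
      using approx[of "m * h"] m \<open>0 < h\<close> by auto
    note [measurable] = transport_planD(3,4)[OF \<pi>]
    note sp = transport_planD(1,2)[OF \<pi>]
    interpret \<pi>: prob_space \<pi>
      using \<mu>(1) transport_planD(3,5)[OF \<pi>] by (metis prob_space_distrD)
    have Dm [measurable]: "D \<in> borel_measurable \<pi>" using int by simp
    have marg: "measure \<pi> (fst -` B) = measure \<mu> B" "measure \<pi> (snd -` B) = measure \<nu> B"
      if "B \<in> sets borel" for B
      using that measure_distr[OF transport_planD(3)[OF \<pi>], of B] measure_distr[OF transport_planD(4)[OF \<pi>], of B]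
        transport_planD(2,5,6)[OF \<pi>] by auto
    have sets_marg: "fst -` B \<in> sets \<pi>" "snd -` B \<in> sets \<pi>" if "B \<in> sets borel" for B
      using measurable_sets[OF transport_planD(3)[OF \<pi>] that] measurable_sets[OF transport_planD(4)[OF \<pi>] that] sp by auto
    have RU: "R -` U \<in> sets borel" using R U by (intro borel_open open_vimage)
    have "measure \<pi> {z. m \<le> D z} \<le> integral\<^sup>L \<pi> D / m"
      using integral_Markov_inequality_measure[OF int(1), of UNIV m] m D(2) sp by simp
    also have "\<dots> < h" using int m by (simp add: divide_simps mult.commute)
    finally have 1: "measure \<pi> {z. m \<le> D z} < h" .
    have "measure \<pi> (fst -` (- cball 0 r)) = 1 - measure \<mu> (cball 0 r)"
      using \<mu>.prob_compl[of "cball 0 r"] \<mu>(2) by (simp add: marg space Compl_eq_Diff_UNIV)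
    with r have 2: "measure \<pi> (fst -` (- cball 0 r)) < h" by simp
    have Dset: "{z. m \<le> D z} \<in> sets \<pi>"
      using measurable_sets[OF Dm, of "{m..}"] sp by (simp add: vimage_def)
    have "measure \<nu> K = measure \<pi> (snd -` K)" using K by (simp add: marg compact_imp_closed)
    \<comment> \<open>A pair with second point in \<open>K\<close> either has \<open>R x\<close> in
      \<open>U\<close>, or has defect at least \<open>m\<close>, or has its first point outside the
      ball. The last two events have mass below \<open>h\<close> each.\<close>
    also have "\<dots> \<le> measure \<pi> (fst -` (R -` U) \<union> ({z. m \<le> D z} \<union> fst -` (- cball 0 r)))"
      using m(2) Dset RU by (intro \<pi>.finite_measure_mono sets.Un sets_marg) (auto simp: C_def)
    also have "\<dots> \<le> measure \<pi> (fst -` (R -` U)) + (measure \<pi> {z. m \<le> D z} + measure \<pi> (fst -` (- cball 0 r)))"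
      using Dset RU
      by (intro order_trans[OF measure_Un_le] add_left_mono sets.Un sets_marg measure_Un_le) auto
    also have "measure \<pi> (fst -` (R -` U)) = measure ?\<rho> U"
      using RU U by (simp add: marg measure_distr space)
    finally show "measure \<nu> K \<le> measure ?\<rho> U + e" using 1 2 by (simp add: h_def)
  qed
  have le: "emeasure \<nu> B \<le> emeasure ?\<rho> B" if B: "B \<in> sets borel" for B
  proof -
    have "emeasure \<nu> B = (SUP K \<in> {K. K \<subseteq> B \<and> compact K}. emeasure \<nu> K)"
      using B \<nu>(2) \<nu>.emeasure_finite by (intro inner_regular) auto
    also have "\<dots> \<le> (INF U \<in> {U. B \<subseteq> U \<and> open U}. emeasure ?\<rho> U)"
      using KU by (auto intro!: SUP_least INF_greatest simp: \<nu>.emeasure_eq_measure \<rho>.emeasure_eq_measure)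
    also have "\<dots> = emeasure ?\<rho> B"
      using B \<rho>.emeasure_finite by (intro outer_regular[symmetric]) auto
    finally show ?thesis .
  qed
  show ?thesis
  proof (rule measure_eqI)
    fix B assume "B \<in> sets \<nu>"
    then have B: "B \<in> sets borel" using \<nu>(2) by simp
    \<comment> \<open>Both measures have total mass one, so the one-sided bound for a set and for
      its complement forces equality.\<close>
    have "measure \<nu> B \<le> measure ?\<rho> B" "measure \<nu> (UNIV - B) \<le> measure ?\<rho> (UNIV - B)"
      using le[OF B] le[of "UNIV - B"] B by (simp_all add: \<nu>.emeasure_eq_measure \<rho>.emeasure_eq_measure)
    moreover have "measure \<nu> (UNIV - B) = 1 - measure \<nu> B" "measure ?\<rho> (UNIV - B) = 1 - measure ?\<rho> B"
      using \<nu>.prob_compl[of B] \<rho>.prob_compl[of B] B \<nu>(2) by (simp_all add: space)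
    ultimately show "emeasure \<nu> B = emeasure ?\<rho> B"
      by (simp add: \<nu>.emeasure_eq_measure \<rho>.emeasure_eq_measure)
  qed (simp add: \<nu>)
qed

section \<open>A duality criterion for barycenters\<close>

text \<open>Weak duality: by \<open>sum0\<close> the dual value is the same constant for every
  competitor, and \<open>opt\<close> attains it. The inequality \<open>le\<close> is only almost
  sure because a degenerate \<open>M i\<close> may have a potential that is admissible only on a
  null complement's complement, the set carrying \<open>M i\<close>. For \<open>i = 1\<close> it is
  assumed everywhere, giving a continuous nonnegative defect to which
  \<open>distr_eq_of_vanishing_defect\<close> applies.\<close>

lemma wasserstein_barycenters_eqI:
  fixes M :: "nat \<Rightarrow> 'a::euclidean_space measure" and \<phi> \<psi> :: "nat \<Rightarrow> 'a \<Rightarrow> real"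
  assumes p: "0 < p" and N: "1 \<le> N" and w: "\<And>i. i \<in> {1..N} \<Longrightarrow> 0 < w i"
    and M: "\<And>i. i \<in> {1..N} \<Longrightarrow> M i \<in> prob_measures_p p"
    and \<nu>0: "\<nu>0 \<in> prob_measures_p p"
    and plan: "\<And>i. i \<in> {1..N} \<Longrightarrow> plan i \<in> transport_plans (M i) \<nu>0"
    and \<phi>: "\<And>i. i \<in> {1..N} \<Longrightarrow> integrable (M i) (\<phi> i)"
    and \<psi>: "\<And>i \<nu>. i \<in> {1..N} \<Longrightarrow> \<nu> \<in> prob_measures_p p \<Longrightarrow> integrable \<nu> (\<psi> i)"
    and le: "\<And>i. i \<in> {1..N} \<Longrightarrow> AE x in M i. \<forall>z. \<phi> i x + \<psi> i z \<le> w i * dist x z powr p"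
    and opt: "\<And>i. i \<in> {1..N} \<Longrightarrow>
      w i * (\<integral>z. dist (fst z) (snd z) powr p \<partial>plan i) \<le> integral\<^sup>L (M i) (\<phi> i) + integral\<^sup>L \<nu>0 (\<psi> i)"
    and sum0: "\<And>z. (\<Sum>i=1..N. \<psi> i z) = 0"
    and cont: "continuous_on UNIV (\<phi> 1)" "continuous_on UNIV (\<psi> 1)" "continuous_on UNIV R"
    and le1: "\<And>x z. \<phi> 1 x + \<psi> 1 z \<le> w 1 * dist x z powr p"
    and strict: "\<And>x z. \<phi> 1 x + \<psi> 1 z = w 1 * dist x z powr p \<Longrightarrow> z = R x"
  shows "wasserstein_barycenters p N w M = {\<nu>0}"
proof -
  define F where "F \<nu> = (\<Sum>i=1..N. w i * wasserstein_dist p (M i) \<nu> powr p)" for \<nu>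
  define J where "J \<nu> i = integral\<^sup>L (M i) (\<phi> i) + integral\<^sup>L \<nu> (\<psi> i)" for \<nu> i
  define c where "c = (\<Sum>i=1..N. integral\<^sup>L (M i) (\<phi> i))"
  have J_sum: "(\<Sum>i=1..N. J \<nu> i) = c" if "\<nu> \<in> prob_measures_p p" for \<nu>
  proof -
    have "(\<Sum>i=1..N. integral\<^sup>L \<nu> (\<psi> i)) = (\<integral>z. (\<Sum>i=1..N. \<psi> i z) \<partial>\<nu>)"
      using \<psi> that by (intro Bochner_Integration.integral_sum[symmetric]) auto
    then show ?thesis unfolding J_def by (simp add: sum.distrib c_def sum0 del: One_nat_def)
  qed
  have plan_int: "integrable \<pi> (\<lambda>z. \<phi> i (fst z) + \<psi> i (snd z))"
      "(\<integral>z. \<phi> i (fst z) + \<psi> i (snd z) \<partial>\<pi>) = J \<nu> i"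
    if i: "i \<in> {1..N}" and \<nu>: "\<nu> \<in> prob_measures_p p" and \<pi>: "\<pi> \<in> transport_plans (M i) \<nu>" for i \<nu> \<pi>
    using transport_plan_integral(1,3)[OF \<pi> \<phi>[OF i]] transport_plan_integral(2,4)[OF \<pi> \<psi>[OF i \<nu>]]
    by (simp_all add: J_def)
  have J_le: "J \<nu> i \<le> w i * wasserstein_dist p (M i) \<nu> powr p"
    if i: "i \<in> {1..N}" and \<nu>: "\<nu> \<in> prob_measures_p p" for i \<nu>
  proof -
    have "J \<nu> i / w i \<le> wasserstein_dist p (M i) \<nu> powr p"
    proof (rule wasserstein_dist_powr_ge[OF p M[OF i] \<nu>])
      fix \<pi> assume \<pi>: "\<pi> \<in> transport_plans (M i) \<nu>"
      have "AE x in distr \<pi> borel fst. \<forall>z. \<phi> i x + \<psi> i z \<le> w i * dist x z powr p"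
        unfolding transport_planD(5)[OF \<pi>] by (rule le[OF i])
      then have "AE z in \<pi>. \<phi> i (fst z) + \<psi> i (snd z) \<le> w i * dist (fst z) (snd z) powr p"
        using AE_distrD[OF transport_planD(3)[OF \<pi>]] by fastforce
      then have "J \<nu> i \<le> (\<integral>z. w i * dist (fst z) (snd z) powr p \<partial>\<pi>)"
        using p unfolding plan_int(2)[OF i \<nu> \<pi>, symmetric]
        by (intro integral_mono_AE plan_int[OF i \<nu> \<pi>] integrable_mult_right
            integrable_transport_cost[OF _ M[OF i] \<nu> \<pi>]) auto
      then show "J \<nu> i / w i \<le> (\<integral>z. dist (fst z) (snd z) powr p \<partial>\<pi>)"
        using w[OF i] by (simp add: divide_simps mult.commute)
    qed
    then show ?thesis using w[OF i] by (simp add: divide_simps mult.commute)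
  qed
  have F_ge: "c \<le> F \<nu>" if "\<nu> \<in> prob_measures_p p" for \<nu>
    unfolding F_def J_sum[OF that, symmetric] using J_le that by (intro sum_mono) auto
  have "F \<nu>0 \<le> (\<Sum>i=1..N. J \<nu>0 i)"
    unfolding F_def J_def
    by (intro sum_mono order_trans[OF mult_left_mono opt] wasserstein_dist_powr_le[OF p M \<nu>0 plan])
       (use w in \<open>auto intro: less_imp_le\<close>)
  then have F_min: "F \<nu>0 \<le> c" using J_sum[OF \<nu>0] by simp
  have uniq: "\<nu> = distr (M 1) borel R" if \<nu>: "\<nu> \<in> prob_measures_p p" and "F \<nu> \<le> c" for \<nu>
  proof -
    have i1: "1 \<in> {1..N}" using N by simp
    have "(\<Sum>i=1..N. w i * wasserstein_dist p (M i) \<nu> powr p - J \<nu> i) \<le> 0"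
      using \<open>F \<nu> \<le> c\<close> J_sum[OF \<nu>] by (simp add: sum_subtractf F_def)
    \<comment> \<open>All duality gaps are nonnegative and their sum is at most zero, so the first
      one is at most zero as well.\<close>
    moreover have "w 1 * wasserstein_dist p (M 1) \<nu> powr p - J \<nu> 1
        \<le> (\<Sum>i=1..N. w i * wasserstein_dist p (M i) \<nu> powr p - J \<nu> i)"
      using J_le \<nu> i1 
      by (intro member_le_sum[of 1 "{1..N}" "\<lambda>i. w i * wasserstein_dist p (M i) \<nu> powr p - J \<nu> i"]) auto
    ultimately have W1: "w 1 * wasserstein_dist p (M 1) \<nu> powr p \<le> J \<nu> 1" by simp
    let ?D = "\<lambda>z. w 1 * dist (fst z) (snd z) powr p - (\<phi> 1 (fst z) + \<psi> 1 (snd z))"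
    note M1 = prob_measures_pD[OF M[OF i1]] and \<nu>' = prob_measures_pD[OF \<nu>]
    show ?thesis
    proof (rule distr_eq_of_vanishing_defect[of _ _ ?D])
      have "continuous_on UNIV (\<lambda>z::'a\<times>'a. \<phi> 1 (fst z))" "continuous_on UNIV (\<lambda>z::'a\<times>'a. \<psi> 1 (snd z))"
        by (rule continuous_on_compose2[OF cont(1)] continuous_on_compose2[OF cont(2)];
            auto intro: continuous_intros)+
      then show "continuous_on UNIV ?D"
        using p by (intro continuous_intros continuous_on_powr') auto
      fix e :: real assume e: "0 < e"
      obtain \<pi> where \<pi>: "\<pi> \<in> transport_plans (M 1) \<nu>"
        "(\<integral>z. dist (fst z) (snd z) powr p \<partial>\<pi>) < wasserstein_dist p (M 1) \<nu> powr p + e / w 1"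
        using wasserstein_dist_powr_approx[OF p M[OF i1] \<nu>, of "e / w 1"] e w[OF i1] by auto
      have c: "integrable \<pi> (\<lambda>z. w 1 * dist (fst z) (snd z) powr p)"
        using p by (intro integrable_mult_right integrable_transport_cost[OF _ M[OF i1] \<nu> \<pi>(1)]) auto
      have "integral\<^sup>L \<pi> ?D = w 1 * (\<integral>z. dist (fst z) (snd z) powr p \<partial>\<pi>) - J \<nu> 1"
        using plan_int[OF i1 \<nu> \<pi>(1)] c by (subst Bochner_Integration.integral_diff) auto
      also have "\<dots> < w 1 * (wasserstein_dist p (M 1) \<nu> powr p + e / w 1) - J \<nu> 1"
        using \<pi>(2) w[OF i1] by simp
      also have "\<dots> \<le> e" using W1 w[OF i1] by (simp add: distrib_left)
      finally show "\<exists>\<pi>\<in>transport_plans (M 1) \<nu>. integrable \<pi> ?D \<and> integral\<^sup>L \<pi> ?D < e"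
        using \<pi>(1) c plan_int(1)[OF i1 \<nu> \<pi>(1)] by (intro bexI[of _ \<pi>]) auto
    qed (use M1 \<nu>' le1 cont strict in auto)
  qed
  show ?thesis
  proof (intro equalityI subsetI)
    fix \<nu> assume "\<nu> \<in> wasserstein_barycenters p N w M"
    then have "\<nu> \<in> prob_measures_p p" "\<not> F \<nu>0 < F \<nu>"
      using \<nu>0 by (auto simp: wasserstein_barycenters_def is_arg_min_def F_def)
    \<comment> \<open>\<open>\<nu>0\<close> also attains the value \<open>c\<close>, so
      \<open>uniq\<close> identifies both measures with the same pushforward of
      \<open>M 1\<close>.\<close>
    then show "\<nu> \<in> {\<nu>0}" using uniq[of \<nu>] uniq[OF \<nu>0] F_min by simp
  next
    fix \<nu> assume "\<nu> \<in> {\<nu>0}"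
    moreover have "\<not> F \<nu> < F \<nu>0" if "\<nu> \<in> prob_measures_p p" for \<nu>
      using F_ge[OF that] F_min by simp
    ultimately show "\<nu> \<in> wasserstein_barycenters p N w M"
      using \<nu>0 by (auto simp: wasserstein_barycenters_def is_arg_min_def F_def)
  qed
qed

text \<open>The criterion for the plans induced by \<open>(T i, S)\<close>: the dual inequality is
  needed only at points \<open>T i x\<close>, and optimality becomes a pointwise identity along
  \<open>\<mu>\<close>.\<close>

lemma wasserstein_barycenters_pushforward:
  fixes \<mu> :: "'a::euclidean_space measure" and T :: "nat \<Rightarrow> 'a \<Rightarrow> 'a" and \<phi> \<psi> :: "nat \<Rightarrow> 'a \<Rightarrow> real"
  assumes p: "0 < p" and N: "1 \<le> N" and w: "\<And>i. i \<in> {1..N} \<Longrightarrow> 0 < w i"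
    and \<mu>: "sets \<mu> = sets borel"
    and T: "\<And>i. i \<in> {1..N} \<Longrightarrow> continuous_on UNIV (T i)"
      "\<And>i. i \<in> {1..N} \<Longrightarrow> distr \<mu> borel (T i) \<in> prob_measures_p p"
    and S: "continuous_on UNIV S" "distr \<mu> borel S \<in> prob_measures_p p"
    and \<phi>: "\<And>i. i \<in> {1..N} \<Longrightarrow> continuous_on UNIV (\<phi> i)"
      "\<And>i. i \<in> {1..N} \<Longrightarrow> \<exists>C. \<forall>x. \<bar>\<phi> i x\<bar> \<le> C * (1 + norm x powr p)"
    and \<psi>: "\<And>i. i \<in> {1..N} \<Longrightarrow> continuous_on UNIV (\<psi> i)"
      "\<And>i. i \<in> {1..N} \<Longrightarrow> \<exists>C. \<forall>x. \<bar>\<psi> i x\<bar> \<le> C * (1 + norm x powr p)"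
    and le: "\<And>i x z. i \<in> {1..N} \<Longrightarrow> \<phi> i (T i x) + \<psi> i z \<le> w i * dist (T i x) z powr p"
    and eq: "\<And>i x. i \<in> {1..N} \<Longrightarrow> \<phi> i (T i x) + \<psi> i (S x) = w i * dist (T i x) (S x) powr p"
    and sum0: "\<And>z. (\<Sum>i=1..N. \<psi> i z) = 0"
    and R: "continuous_on UNIV R"
    and le1: "\<And>x z. \<phi> 1 x + \<psi> 1 z \<le> w 1 * dist x z powr p"
    and strict: "\<And>x z. \<phi> 1 x + \<psi> 1 z = w 1 * dist x z powr p \<Longrightarrow> z = R x"
  shows "wasserstein_barycenters p N w (\<lambda>i. distr \<mu> borel (T i)) = {distr \<mu> borel S}"
proof (rule wasserstein_barycenters_eqI[where \<phi>=\<phi> and \<psi>=\<psi> and R=R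
      and plan = "\<lambda>i. distr \<mu> borel (\<lambda>x. (T i x, S x))"])
  have meas: "f \<in> \<mu> \<rightarrow>\<^sub>M borel" if "continuous_on UNIV f" for f :: "'a \<Rightarrow> 'b::topological_space"
    using that by (simp add: measurable_cong_sets[OF \<mu> refl] borel_measurable_continuous_onI)
  fix i assume i: "i \<in> {1..N}"
  have TS: "(\<lambda>x. (T i x, S x)) \<in> \<mu> \<rightarrow>\<^sub>M borel"
    using T(1)[OF i] S(1) by (intro meas continuous_intros)
  have fs: "(fst :: 'a \<times> 'a \<Rightarrow> 'a) \<in> borel \<rightarrow>\<^sub>M borel" "(snd :: 'a \<times> 'a \<Rightarrow> 'a) \<in> borel \<rightarrow>\<^sub>M borel"
    by (auto intro!: borel_measurable_continuous_onI continuous_intros)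
  show "distr \<mu> borel (\<lambda>x. (T i x, S x)) \<in> transport_plans (distr \<mu> borel (T i)) (distr \<mu> borel S)"
    using TS fs by (auto simp: transport_plans_def distr_distr comp_def)
  show \<phi>i: "integrable (distr \<mu> borel (T i)) (\<phi> i)"
    using \<phi>(2)[OF i] integrable_of_powr_growth[OF T(2)[OF i] \<phi>(1)[OF i]] by blast
  show \<psi>i: "integrable \<nu> (\<psi> i)" if "\<nu> \<in> prob_measures_p p" for \<nu>
    using \<psi>(2)[OF i] integrable_of_powr_growth[OF that \<psi>(1)[OF i]] by blast
  \<comment> \<open>Closedness makes the condition on \<open>x\<close> measurable despite the
    quantifier over all \<open>z\<close>, so the almost-sure statement can be pulled back along
    \<open>T i\<close>.\<close>
  have "closed {x. \<forall>z. \<phi> i x + \<psi> i z \<le> w i * dist x z powr p}"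
    using p by (intro closed_Collect_all closed_Collect_le continuous_intros \<phi>(1)[OF i] continuous_on_powr') auto
  then have "Measurable.pred borel (\<lambda>x. \<forall>z. \<phi> i x + \<psi> i z \<le> w i * dist x z powr p)"
    by (simp add: pred_def borel_closed)
  then show "AE x in distr \<mu> borel (T i). \<forall>z. \<phi> i x + \<psi> i z \<le> w i * dist x z powr p"
    using le[OF i] by (subst AE_distr_iff) (auto simp: pred_def meas[OF T(1)[OF i]])
  have dm: "(\<lambda>z::'a\<times>'a. dist (fst z) (snd z) powr p) \<in> borel_measurable borel"
    using p by (intro borel_measurable_continuous_onI continuous_intros continuous_on_powr') auto
  have "w i * (\<integral>z. dist (fst z) (snd z) powr p \<partial>distr \<mu> borel (\<lambda>x. (T i x, S x)))
      = (\<integral>x. \<phi> i (T i x) + \<psi> i (S x) \<partial>\<mu>)"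
    using integral_distr[OF TS dm] by (simp add: eq[OF i])
  also have "\<dots> = integral\<^sup>L (distr \<mu> borel (T i)) (\<phi> i) + integral\<^sup>L (distr \<mu> borel S) (\<psi> i)"
    using \<phi>i \<psi>i[OF S(2)] meas[OF T(1)[OF i]] meas[OF S(1)] 
    by (simp add: integral_distr integrable_distr_eq borel_measurable_continuous_onI \<phi>(1)[OF i] \<psi>(1)[OF i])
  finally show "w i * (\<integral>z. dist (fst z) (snd z) powr p \<partial>distr \<mu> borel (\<lambda>x. (T i x, S x)))
      \<le> integral\<^sup>L (distr \<mu> borel (T i)) (\<phi> i) + integral\<^sup>L (distr \<mu> borel S) (\<psi> i)" by simp
qed (use assms in auto)

lemma norm_affine_powr_growth:
  fixes B :: "real^'n^'m"
  assumes p: "0 < p"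
  shows "\<exists>C. \<forall>x. norm (B *v x + u) powr p \<le> C * (1 + norm x powr p)"
proof -
  obtain K where K: "0 < K" "\<And>x. norm (B *v x) \<le> norm x * K"
    using bounded_linear.pos_bounded[OF matrix_vector_mul_bounded_linear[of B]] by blast
  have "norm (B *v x + u) powr p \<le> 2 powr p * (K powr p + norm u powr p) * (1 + norm x powr p)" for x
  proof -
    have "norm (B *v x + u) powr p \<le> 2 powr p * (norm (B *v x) powr p + norm u powr p)"
      using norm_diff_powr_le[of p "B *v x" "- u"] p by simp
    also have "norm (B *v x) powr p \<le> (norm x * K) powr p"
      using K p by (intro powr_mono2) auto
    also have "(norm x * K) powr p = K powr p * norm x powr p"
      using K by (simp add: powr_mult)
    also have "2 powr p * (K powr p * norm x powr p + norm u powr p)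
        \<le> 2 powr p * ((K powr p + norm u powr p) * (1 + norm x powr p))"
      by (intro mult_left_mono) (auto simp: algebra_simps)
    finally show ?thesis by (simp add: mult.assoc)
  qed
  then show ?thesis by blast
qed

lemma continuous_on_matrix_vector_mult_left [continuous_intros]:
  fixes B :: "real^'n^'m"
  shows "continuous_on S f \<Longrightarrow> continuous_on S (\<lambda>x. B *v f x)"
  by (rule continuous_on_compose2[OF matrix_vector_mult_linear_continuous_on[of UNIV B]]) auto

lemma distr_affine_in_prob_measures_p:
  fixes \<mu> :: "(real^'n) measure" and B :: "real^'n^'n"
  assumes p: "0 < p" and \<mu>: "\<mu> \<in> prob_measures_p p"
  shows "distr \<mu> borel (\<lambda>x. B *v x + u) \<in> prob_measures_p p"
proof -
  note \<mu>D = prob_measures_pD[OF \<mu>]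
  interpret prob_space \<mu> by (rule \<mu>D)
  have cont: "continuous_on UNIV (\<lambda>x. B *v x + u)"
    by (intro continuous_intros)
  then have meas: "(\<lambda>x. B *v x + u) \<in> \<mu> \<rightarrow>\<^sub>M borel"
    by (simp add: measurable_cong_sets[OF \<mu>D(2) refl] borel_measurable_continuous_onI)
  obtain C where C: "\<And>x. norm (B *v x + u) powr p \<le> C * (1 + norm x powr p)"
    using norm_affine_powr_growth[OF p, of B u] by auto
  have "integrable \<mu> (\<lambda>x. norm (B *v x + u) powr p)"
    using p C by (intro integrable_of_powr_growth[OF \<mu>, of _ C] continuous_on_powr' continuous_intros cont) auto
  moreover have "(\<lambda>x. norm x powr p) \<in> borel_measurable (borel :: (real^'n) measure)" by measurable
  ultimately show ?thesis
    using meas prob_space_distr[OF meas] by (simp add: prob_measures_p_def integrable_distr_eq)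
qed

section \<open>Symmetric matrices with two eigenvalues\<close>

lemma symmetric_matrix_inner:
  fixes A :: "real^'n^'n"
  assumes "transpose A = A"
  shows "(A *v x) \<bullet> y = x \<bullet> (A *v y)"
  by (metis assms dot_lmul_matrix transpose_matrix_vector)

text \<open>A maximizer of the Rayleigh quotient on the subspace is an eigenvector.\<close>

lemma symmetric_matrix_eigenvector:
  fixes A :: "real^'n^'n"
  assumes sym: "transpose A = A" and W: "subspace W" "u \<in> W" "u \<noteq> 0"
    and inv: "\<And>x. x \<in> W \<Longrightarrow> A *v x \<in> W"
  obtains c x where "x \<in> W" "x \<noteq> 0" "A *v x = c *\<^sub>R x"
proof -
  define K where "K = sphere 0 1 \<inter> W"
  have "compact K"
    unfolding K_def using W by (intro compact_Int_closed closed_subspace) auto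
  moreover have "(1 / norm u) *\<^sub>R u \<in> K"
    unfolding K_def using W by (auto intro: subspace_mul)
  moreover have "continuous_on K (\<lambda>x. x \<bullet> (A *v x))"
    by (intro continuous_intros matrix_vector_mult_linear_continuous_on)
  ultimately obtain x where x: "x \<in> K" and max: "\<And>y. y \<in> K \<Longrightarrow> y \<bullet> (A *v y) \<le> x \<bullet> (A *v x)"
    using continuous_attains_sup[of K "\<lambda>x. x \<bullet> (A *v x)"] by blast
  define m where "m = x \<bullet> (A *v x)"
  \<comment> \<open>By maximality \<open>q\<close> is nonnegative on \<open>W\<close>, and it
    vanishes at \<open>x\<close>; hence its first variation at \<open>x\<close> vanishes in all
    directions of \<open>W\<close>.\<close>
  define q where "q y = m * (y \<bullet> y) - y \<bullet> (A *v y)" for y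
  have xW: "x \<in> W" and x1: "norm x = 1" using x by (auto simp: K_def)
  have q_nonneg: "0 \<le> q y" if "y \<in> W" for y
  proof (cases "y = 0")
    case False
    have "(1 / norm y) *\<^sub>R y \<in> K"
      unfolding K_def using W that False by (auto intro: subspace_mul)
    from max[OF this] have "(y \<bullet> (A *v y)) / (norm y * norm y) \<le> m"
      by (simp add: m_def matrix_vector_mult_scaleR)
    then show ?thesis
      using False by (simp add: q_def divide_simps dot_square_norm power2_eq_square)
  qed (simp add: q_def)
  have orth: "y \<bullet> (m *\<^sub>R x - A *v x) = 0" if "y \<in> W" for y
  proof (rule ccontr)
    define b where "b = y \<bullet> (m *\<^sub>R x - A *v x)"
    assume "y \<bullet> (m *\<^sub>R x - A *v x) \<noteq> 0"
    then have b: "b \<noteq> 0" by (simp add: b_def)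
    \<comment> \<open>A step against the slope \<open>b\<close>. The \<open>+ 1\<close> keeps the
      denominator positive when \<open>q y = 0\<close> and still leaves \<open>q (x + t y)\<close>
      negative.\<close>
    define t where "t = - b / (q y + 1)"
    have qy: "0 < q y + 1" using q_nonneg[OF that] by simp
    have "q (x + t *\<^sub>R y) = q x + 2 * t * b + t\<^sup>2 * q y"
      using symmetric_matrix_inner[OF sym, of x y]
      by (simp add: q_def b_def matrix_vector_right_distrib matrix_vector_mult_scaleR inner_add_left
          inner_add_right inner_diff_right inner_commute power2_eq_square algebra_simps)
    also have "q x = 0" using x1 by (simp add: q_def m_def dot_square_norm)
    also have "0 + 2 * t * b + t\<^sup>2 * q y = - b\<^sup>2 * (q y + 2) / (q y + 1)\<^sup>2"
      using qy by (simp add: t_def power2_eq_square divide_simps) (simp add: algebra_simps)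
    also have "\<dots> < 0" using b qy by (simp add: divide_neg_pos mult_neg_pos)
    finally show False
      using q_nonneg[of "x + t *\<^sub>R y"] W xW that by (simp add: subspace_add subspace_mul)
  qed
  have "m *\<^sub>R x - A *v x \<in> W" using W xW inv by (simp add: subspace_diff subspace_mul)
  then have "A *v x = m *\<^sub>R x" using orth by (metis inner_eq_zero_iff eq_iff_diff_eq_0)
  then show ?thesis using that[of x m] xW x1 by (metis norm_zero zero_neq_one)
qed

lemma eigenvalue_in_matrix_spectrum:
  fixes A :: "real^'n^'n"
  assumes "A *v x = c *\<^sub>R x" "x \<noteq> 0"
  shows "complex_of_real c \<in> matrix_spectrum A"
proof (rule ccontr)
  let ?M = "map_matrix complex_of_real A - mat (complex_of_real c)"
  let ?y = "\<chi> i. complex_of_real (x $ i)"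
  assume "complex_of_real c \<notin> matrix_spectrum A"
  then obtain B where B: "B ** ?M = mat 1"
    by (auto simp: matrix_spectrum_def invertible_def)
  have "(\<Sum>j\<in>UNIV. A $ i $ j * x $ j) = c * x $ i" for i
    using assms(1) by (simp add: vec_eq_iff matrix_vector_mult_def)
  then have "(\<Sum>j\<in>UNIV. complex_of_real (A $ i $ j) * complex_of_real (x $ j)) = complex_of_real (c * x $ i)" for i
    by (metis (no_types, lifting) of_real_mult of_real_sum sum.cong)
  then have "map_matrix complex_of_real A *v ?y = mat (complex_of_real c) *v ?y"
    by (simp add: vec_eq_iff matrix_vector_mult_def map_matrix_def mat_def if_distrib[of "\<lambda>z. z * _"] cong: if_cong)
  then have "?M *v ?y = 0" by (simp add: matrix_vector_mult_diff_rdistrib)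
  then have "(B ** ?M) *v ?y = 0" by (metis matrix_vector_mul_assoc matrix_vector_mult_0_right)
  then have "?y = 0" by (simp add: B)
  then show False using assms(2) by (simp add: vec_eq_iff)
qed

text \<open>This says \<open>(A - b)\<close> followed by \<open>(A - a)\<close> is zero. Otherwise
  the range of the product is a nonzero invariant subspace and contains an eigenvector
  \<open>x\<close>, with eigenvalue \<open>a\<close> or \<open>b\<close>. One factor kills
  \<open>x\<close>, while \<open>x\<close> lies in the range of that same self-adjoint factor, so
  \<open>x\<close> is orthogonal to itself.\<close>

lemma symmetric_matrix_annihilated:
  fixes A :: "real^'n^'n"
  assumes sym: "transpose A = A"
    and spec: "matrix_spectrum A \<subseteq> {complex_of_real a, complex_of_real b}"
  shows "A *v (A *v u - b *\<^sub>R u) = a *\<^sub>R (A *v u - b *\<^sub>R u)"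
proof (rule ccontr)
  define L where "L c x = A *v x - c *\<^sub>R x" for c x
  define W where "W = range (\<lambda>u. L a (L b u))"
  have lin: "linear (\<lambda>u. L a (L b u))" 
    unfolding L_def by (intro linearI) (simp_all add: matrix_vector_right_distrib matrix_vector_mult_diff_distrib
      matrix_vector_mult_scaleR algebra_simps)
  have comm: "L c (L d x) = L d (L c x)" for c d x
    by (simp add: L_def matrix_vector_mult_diff_distrib matrix_vector_mult_scaleR algebra_simps)
  have selfadj: "L c x \<bullet> y = x \<bullet> L c y" for c x y
    using symmetric_matrix_inner[OF sym] by (simp add: L_def inner_diff_left inner_diff_right)
  have A_comm: "A *v L c x = L c (A *v x)" for c x
    by (simp add: L_def matrix_vector_mult_diff_distrib matrix_vector_mult_scaleR)
  assume "\<not> ?thesis"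
  then have "L a (L b u) \<noteq> 0" by (simp add: L_def)
  moreover have "subspace W" unfolding W_def by (rule linear_subspace_image[OF lin]) simp
  moreover have "A *v x \<in> W" if "x \<in> W" for x using that by (auto simp: W_def A_comm)
  ultimately obtain c x where x: "x \<in> W" "x \<noteq> 0" "A *v x = c *\<^sub>R x"
    using symmetric_matrix_eigenvector[OF sym, of W "L a (L b u)"] unfolding W_def by blast
  then obtain y where y: "x = L a (L b y)" by (auto simp: W_def)
  have "c = a \<or> c = b" using eigenvalue_in_matrix_spectrum[OF x(3,2)] spec by auto
  then have "x \<bullet> x = 0"
  proof
    assume "c = a"
    then have "L a x = 0" using x by (simp add: L_def)
    then have "x \<bullet> L a (L b y) = 0" by (subst selfadj[symmetric]) simp
    then show ?thesis using y by simp
  next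
    assume "c = b"
    then have "L b x = 0" using x by (simp add: L_def)
    then have "x \<bullet> L b (L a y) = 0" by (subst selfadj[symmetric]) simp
    then show ?thesis using y comm by simp
  qed
  with x show False by simp
qed

text \<open>\<open>Q\<close> is the orthogonal projection onto the
  \<open>\<zeta>\<close>-eigenspace, obtained by normalizing \<open>A - mat 1\<close>.\<close>

lemma symmetric_matrix_two_eigenvalues:
  fixes A :: "real^'n^'n"
  assumes sym: "transpose A = A" and spec: "matrix_spectrum A \<subseteq> {1, complex_of_real \<zeta>}"
    and ne: "A \<noteq> mat 1"
  obtains Q where "transpose Q = Q" "Q ** Q = Q" "A = mat 1 - Q + \<zeta> *\<^sub>R Q"
    "eigenspace A 1 = {x. Q *v x = 0}"
proof -
  have ann: "A *v (A *v u - u) = \<zeta> *\<^sub>R (A *v u - u)" for u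
    using symmetric_matrix_annihilated[OF sym, of \<zeta> 1 u] spec by (simp add: insert_commute)
  \<comment> \<open>Allows division by \<open>\<zeta> - 1\<close>: for \<open>\<zeta> = 1\<close>
    the symmetric matrix \<open>A - mat 1\<close> would square to zero, hence vanish.\<close>
  have \<zeta>: "\<zeta> \<noteq> 1"
  proof
    assume "\<zeta> = 1"
    have "A *v u = u" for u
    proof -
      have "(A *v u - u) \<bullet> (A *v u - u) = u \<bullet> (A *v (A *v u - u) - (A *v u - u))"
        using symmetric_matrix_inner[OF sym, of u "A *v u - u"] by (simp add: inner_diff_left inner_diff_right)
      also have "\<dots> = 0" using ann[of u] \<open>\<zeta> = 1\<close> by simp
      finally show ?thesis by simp
    qed
    then show False using ne by (simp add: matrix_eq)
  qed
  define Q where "Q = (1 / (\<zeta> - 1)) *\<^sub>R (A - mat 1)"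
  have Qv: "Q *v x = (1 / (\<zeta> - 1)) *\<^sub>R (A *v x - x)" for x
    by (simp add: Q_def scaleR_matrix_vector_assoc[symmetric] matrix_vector_mult_diff_rdistrib)
  show ?thesis
  proof
    show "transpose Q = Q"
      using sym by (simp add: Q_def transpose_def vec_eq_iff mat_def)
    have "Q *v (Q *v x) = Q *v x" for x
    proof -
      have "A *v (Q *v x) = \<zeta> *\<^sub>R (Q *v x)"
        by (simp add: Qv matrix_vector_mult_scaleR ann scaleR_left_commute)
      then have "Q *v (Q *v x) = (1 / (\<zeta> - 1)) *\<^sub>R ((\<zeta> - 1) *\<^sub>R (Q *v x))"
        using Qv[of "Q *v x"] by (simp add: scaleR_left_diff_distrib)
      then show ?thesis using \<zeta> by simp
    qed
    then show "Q ** Q = Q" by (simp add: matrix_eq flip: matrix_vector_mul_assoc)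
    have "(\<zeta> - 1) *\<^sub>R Q = A - mat 1" using \<zeta> by (simp add: Q_def)
    then show "A = mat 1 - Q + \<zeta> *\<^sub>R Q" by (simp add: scaleR_left_diff_distrib algebra_simps)
    show "eigenspace A 1 = {x. Q *v x = 0}" using \<zeta> by (auto simp: eigenspace_def Qv)
  qed
qed

text \<open>\<open>x - Q' x\<close> lies in the common kernel, so \<open>Q = Q Q'\<close>;
  transposing gives \<open>Q = Q' Q\<close>, which is \<open>Q'\<close> by the same argument with
  the roles exchanged.\<close>

lemma orthogonal_projection_eqI:
  fixes Q Q' :: "real^'n^'n"
  assumes Q: "transpose Q = Q" "Q ** Q = Q" and Q': "transpose Q' = Q'" "Q' ** Q' = Q'"
    and ker: "{x. Q *v x = 0} = {x. Q' *v x = 0}"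
  shows "Q = Q'"
proof -
  have *: "P = P ** P'" if "P' ** P' = P'" "{x. P *v x = 0} = {x. P' *v x = 0}" for P P' :: "real^'n^'n"
  proof -
    have "P' *v (x - P' *v x) = 0" for x
      using that(1) by (simp add: matrix_vector_mult_diff_distrib matrix_vector_mul_assoc)
    then have "P *v (x - P' *v x) = 0" for x using that(2) by blast
    then show ?thesis
      by (simp add: matrix_eq matrix_vector_mult_diff_distrib flip: matrix_vector_mul_assoc)
  qed
  have "Q = transpose (Q ** Q')" using *[OF Q'(2) ker] Q(1) by simp
  also have "\<dots> = Q' ** Q" by (simp add: matrix_transpose_mul Q Q')
  also have "\<dots> = Q'" using *[OF Q(2) ker[symmetric]] by simp
  finally show ?thesis .
qed

lemma orthogonal_projection_norm:
  fixes Q :: "real^'n^'n"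
  assumes "transpose Q = Q" "Q ** Q = Q"
  shows "(norm x)\<^sup>2 = (norm (Q *v x))\<^sup>2 + (norm (x - Q *v x))\<^sup>2"
proof -
  have "(Q *v x) \<bullet> (Q *v x) = x \<bullet> (Q *v x)"
    using symmetric_matrix_inner[OF assms(1), of x "Q *v x"] assms(2) by (simp add: matrix_vector_mul_assoc)
  then show ?thesis
    by (simp add: power2_norm_eq_inner inner_diff_left inner_diff_right inner_commute)
qed

section \<open>Potentials and barycenters\<close>

text \<open>Matches the gradient on the line with the signed coefficient that appears in
  \<open>ray_potential\<close>.\<close>

lemma norm_powr_grad_real:
  "norm_powr_grad p (d::real) = p * (sgn d * \<bar>d\<bar> powr (p - 1))"
proof (cases "d = 0")
  case False
  then have "\<bar>d\<bar> powr (p - 2) * d = sgn d * \<bar>d\<bar> powr (p - 1)"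
    using powr_add[of "\<bar>d\<bar>" "p - 2" 1] by (simp add: sgn_mult_abs mult.left_commute abs_mult_sgn mult.assoc)
  then show ?thesis by (simp add: norm_powr_grad_def)
qed simp

text \<open>Kantorovich potentials for the cost \<open>\<bar>y - z\<bar>\<^sup>p\<close> adapted to the plan concentrated on the pairs
  \<open>(t u, s u)\<close>. For \<open>t = 0\<close> the first potential should be \<open>-\<infinity>\<close> off the origin; the convention
  \<open>0 powr a = 0\<close> makes it \<open>0\<close>, whence the restriction to \<open>y = 0\<close> in that case.\<close>

definition ray_potential :: "real \<Rightarrow> real \<Rightarrow> real \<Rightarrow> 'a::real_inner \<Rightarrow> 'a \<Rightarrow> real" where
  "ray_potential p t s y z = sgn (t - s) * \<bar>t - s\<bar> powr (p - 1) *
     (t powr (1 - p) * norm y powr p - s powr (1 - p) * norm z powr p)"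

text \<open>Strict subadditivity of the perspective, multiplied by
  \<open>\<bar>t - s\<bar> powr (p - 1)\<close>. For \<open>s < t\<close> it is applied to
  \<open>y = z + (y - z)\<close> with weights \<open>s\<close> and \<open>t - s\<close>; for
  \<open>t < s\<close> to \<open>z = y + (z - y)\<close>. For \<open>t = s\<close> the potential is
  zero and \<open>y\<close> differs from \<open>z\<close>.\<close>

lemma ray_potential_less:
  fixes y z :: "'a::real_inner"
  assumes p: "1 < p" and "0 < s" "0 < t" and ne: "s *\<^sub>R y \<noteq> t *\<^sub>R z"
  shows "ray_potential p t s y z < norm (y - z) powr p"
proof -
  have cancel: "d powr (p - 1) * (d powr (1 - p) * c) = c" if "0 < d" for d c :: real
    using that powr_add[of d "p - 1" "1 - p"] by (simp flip: mult.assoc)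
  consider "t = s" | "s < t" | "t < s" by linarith
  then show ?thesis
  proof cases
    case 1
    then show ?thesis using assms by (auto simp: ray_potential_def)
  next
    case 2
    have "0 < t - s" using 2 by simp
    moreover have "t powr (1 - p) * norm y powr p
        < s powr (1 - p) * norm z powr p + (t - s) powr (1 - p) * norm (y - z) powr p"
      using norm_powr_perspective_add_less[of p s "t - s" z "y - z"] assms 2 by (auto simp: algebra_simps)
    ultimately have "(t - s) powr (p - 1) * (t powr (1 - p) * norm y powr p - s powr (1 - p) * norm z powr p)
        < (t - s) powr (p - 1) * ((t - s) powr (1 - p) * norm (y - z) powr p)"
      using 2 by (intro mult_strict_left_mono) auto
    then show ?thesis using 2 by (simp only: cancel diff_gt_0_iff_gt) (simp add: ray_potential_def)
  next
    case 3
    have "0 < s - t" using 3 by simp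
    moreover have "s powr (1 - p) * norm z powr p
        < t powr (1 - p) * norm y powr p + (s - t) powr (1 - p) * norm (z - y) powr p"
      using norm_powr_perspective_add_less[of p t "s - t" y "z - y"] assms 3 by (auto simp: algebra_simps)
    ultimately have "(s - t) powr (p - 1) * (s powr (1 - p) * norm z powr p - t powr (1 - p) * norm y powr p)
        < (s - t) powr (p - 1) * ((s - t) powr (1 - p) * norm (z - y) powr p)"
      using 3 by (intro mult_strict_left_mono) auto
    then show ?thesis using 3
      by (simp only: cancel diff_gt_0_iff_gt) (simp add: ray_potential_def norm_minus_commute right_diff_distrib)
  qed
qed

text \<open>The same decompositions, now along a common ray, where the perspective is additive. For
  \<open>t = 0\<close> the point \<open>y\<close> is the origin and the two powers of
  \<open>s\<close> cancel.\<close>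

lemma ray_potential_eq:
  fixes y z :: "'a::real_inner"
  assumes p: "1 < p" and "0 < s" "0 \<le> t" and eq: "s *\<^sub>R y = t *\<^sub>R z"
  shows "ray_potential p t s y z = norm (y - z) powr p"
proof -
  have cancel: "d powr (p - 1) * (d powr (1 - p) * c) = c" if "0 < d" for d c :: real
    using that powr_add[of d "p - 1" "1 - p"] by (simp flip: mult.assoc)
  consider "t = s" | "t = 0" | "s < t" | "0 < t" "t < s" using assms by linarith
  then show ?thesis
  proof cases
    case 1
    then show ?thesis using assms by (auto simp: ray_potential_def)
  next
    case 2
    then have "y = 0" using assms by auto
    then show ?thesis using cancel[of s 1] assms(2) 2 by (simp add: ray_potential_def)
  next
    case 3
    have "t powr (1 - p) * norm y powr p
        = s powr (1 - p) * norm z powr p + (t - s) powr (1 - p) * norm (y - z) powr p"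
      using norm_powr_perspective_add_eq[of p s "t - s" z "y - z"] assms 3 by (auto simp: algebra_simps)
    then show ?thesis using cancel[of "t - s" 1] 3 by (simp add: ray_potential_def)
  next
    case 4
    have "s powr (1 - p) * norm z powr p
        = t powr (1 - p) * norm y powr p + (s - t) powr (1 - p) * norm (z - y) powr p"
      using norm_powr_perspective_add_eq[of p t "s - t" y "z - y"] assms 4 by (auto simp: algebra_simps)
    then show ?thesis using cancel[of "s - t" 1] 4
      by (simp add: ray_potential_def norm_minus_commute)
  qed
qed

lemma ray_potential_le:
  fixes y z :: "'a::real_inner"
  assumes "1 < p" "0 < s" "0 \<le> t" "t = 0 \<Longrightarrow> y = 0"
  shows "ray_potential p t s y z \<le> norm (y - z) powr p"
  using ray_potential_less[of p s t y z] ray_potential_eq[of p s t y z] assms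
  by (cases "s *\<^sub>R y = t *\<^sub>R z"; cases "t = 0") auto

section \<open>Barycenters of translates\<close>

lemma wasserstein_barycenters_translates:
  fixes \<mu> :: "(real^'n) measure" and v :: "nat \<Rightarrow> real^'n"
  assumes p: "1 < p" and N: "1 \<le> N" and w: "\<And>i. i \<in> {1..N} \<Longrightarrow> 0 < w i"
    and \<mu>: "\<mu> \<in> prob_measures_p p" and A: "\<And>i. i \<in> {1..N} \<Longrightarrow> A i = mat 1"
  shows "wasserstein_barycenters p N w (\<lambda>i. distr \<mu> borel (\<lambda>x. A i *v x + v i))
       = {distr \<mu> borel (\<lambda>x. xbar p N w A *v x + xbar p N w v)}"
proof -
  define h where "h i = v i - xbar p N w v" for i
  define G where "G i = norm_powr_grad p (h i)" for i
  \<comment> \<open>\<open>\<phi>\<close> and \<open>\<psi>\<close> split the tangent of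
    \<open>norm _ powr p\<close> at \<open>h i\<close>, evaluated at \<open>x - z\<close>, into a
    part in \<open>x\<close> and a part in \<open>z\<close>.\<close>
  define \<phi> where "\<phi> i x = w i * (norm (h i) powr p + G i \<bullet> (x - h i))" for i x
  define \<psi> where "\<psi> i z = - (w i * (G i \<bullet> z))" for i z
  have G0: "(\<Sum>i=1..N. w i *\<^sub>R G i) = 0"
    using xbar_critical[OF p w N, where x=v] by (simp add: G_def h_def)
  have xA: "xbar p N w A = mat 1"
    using p w N by (rule xbar_eqI) (assumption, intro sum.neutral ballI, simp add: A)
  have i1: "1 \<in> {1..N}" using N by simp
  have pot: "\<phi> i x + \<psi> i z = w i * (norm (h i) powr p + G i \<bullet> ((x - z) - h i))" for i x z
    by (simp add: \<phi>_def \<psi>_def inner_diff_right algebra_simps)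
  have le: "\<phi> i x + \<psi> i z \<le> w i * dist x z powr p" if "i \<in> {1..N}" for i x z
    unfolding pot dist_norm G_def
    using w[OF that] by (intro mult_left_mono norm_powr_ge_tangent p) auto
  have growth: "\<exists>C. \<forall>x::real^'n. \<bar>a + b \<bullet> x\<bar> \<le> C * (1 + norm x powr p)" for a and b :: "real^'n"
  proof (intro exI allI)
    fix x :: "real^'n"
    have x: "norm x \<le> 1 + norm x powr p"
    proof (cases "norm x \<le> 1")
      case False
      then have "norm x powr 1 \<le> norm x powr p" using p by (intro powr_mono) auto
      then show ?thesis by simp
    qed (simp add: add_increasing2)
    have "\<bar>a + b \<bullet> x\<bar> \<le> \<bar>a\<bar> * 1 + norm b * norm x"
      using Cauchy_Schwarz_ineq2[of b x] by linarith
    also have "\<dots> \<le> \<bar>a\<bar> * (1 + norm x powr p) + norm b * (1 + norm x powr p)"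
      using x by (intro add_mono mult_left_mono) auto
    finally show "\<bar>a + b \<bullet> x\<bar> \<le> (\<bar>a\<bar> + norm b) * (1 + norm x powr p)"
      by (simp add: distrib_right)
  qed
  show ?thesis
  proof (rule wasserstein_barycenters_pushforward[where \<phi>=\<phi> and \<psi>=\<psi> and R="\<lambda>x. x - h 1"])
    show "\<exists>C. \<forall>x. \<bar>\<phi> i x\<bar> \<le> C * (1 + norm x powr p)" for i
      using growth[of "w i * (norm (h i) powr p - G i \<bullet> h i)" "w i *\<^sub>R G i"]
      by (simp add: \<phi>_def inner_diff_right algebra_simps)
    show "\<exists>C. \<forall>x. \<bar>\<psi> i x\<bar> \<le> C * (1 + norm x powr p)" for i
      using growth[of 0 "- (w i *\<^sub>R G i)"] by (simp add: \<psi>_def)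
    show "\<phi> i (A i *v x + v i) + \<psi> i (xbar p N w A *v x + xbar p N w v)
        = w i * dist (A i *v x + v i) (xbar p N w A *v x + xbar p N w v) powr p"
      if "i \<in> {1..N}" for i x
      unfolding pot dist_norm using A[OF that] by (simp add: xA h_def)
    have "(\<Sum>i=1..N. \<psi> i z) = - ((\<Sum>i=1..N. w i *\<^sub>R G i) \<bullet> z)" for z
      by (simp add: \<psi>_def inner_sum_left sum_negf)
    then show "(\<Sum>i=1..N. \<psi> i z) = 0" for z by (simp only: G0) simp
    \<comment> \<open>A tangent touches the strictly convex power only at its base point, so
      equality means \<open>x - z = h 1\<close>.\<close>
    show "z = x - h 1" if "\<phi> 1 x + \<psi> 1 z = w 1 * dist x z powr p" for x z
    proof (rule ccontr)
      assume "z \<noteq> x - h 1"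
      then have "x - z \<noteq> h 1" by (auto simp: algebra_simps)
      from norm_powr_gt_tangent[OF p this] show False
        using that w[OF i1] unfolding pot dist_norm G_def by simp
    qed
  qed (use p N w \<mu> le le[OF i1] prob_measures_pD[OF \<mu>] in
      \<open>auto intro!: continuous_intros distr_affine_in_prob_measures_p simp: \<phi>_def \<psi>_def\<close>)
qed

section \<open>Barycenters of dilations along one projection\<close>

text \<open>At a nonpositive mean every term of the first-order condition would be nonnegative and
  the first one positive. Positivity is required for the mean to serve as \<open>s\<close> in
  \<open>ray_potential\<close>.\<close>

lemma xbar_pos:
  fixes \<zeta> :: "nat \<Rightarrow> real"
  assumes p: "1 < p" and N: "1 \<le> N" and w: "\<And>i. i \<in> {1..N} \<Longrightarrow> 0 < w i"
    and \<zeta>: "\<And>i. i \<in> {1..N} \<Longrightarrow> 0 \<le> \<zeta> i" and "0 < \<zeta> 1"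
  shows "0 < xbar p N w \<zeta>"
proof (rule ccontr)
  define s where "s = xbar p N w \<zeta>"
  assume "\<not> 0 < xbar p N w \<zeta>"
  then have s: "s \<le> 0" by (simp add: s_def)
  have "0 < (\<Sum>i=1..N. w i *\<^sub>R norm_powr_grad p (\<zeta> i - s))"
  proof (rule sum_pos2[of _ 1])
    show "0 < w 1 *\<^sub>R norm_powr_grad p (\<zeta> 1 - s)"
      using p w[of 1] N s \<open>0 < \<zeta> 1\<close> by (simp add: norm_powr_grad_def)
    show "0 \<le> w i *\<^sub>R norm_powr_grad p (\<zeta> i - s)" if "i \<in> {1..N}" for i
      using p w[OF that] \<zeta>[OF that] s by (simp add: norm_powr_grad_def)
  qed (use N in auto)
  then show False using xbar_critical[OF p w N, where x=\<zeta>] by (simp add: s_def)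
qed

text \<open>All \<open>A i\<close> lie on one line with direction \<open>Q\<close>, so their mean is
  governed by the scalar mean of the \<open>\<zeta> i\<close>. Transport moves only the
  \<open>Q\<close>-component, by dilations about \<open>v0\<close>, and the ray potentials are
  evaluated on that component.\<close>

lemma wasserstein_barycenters_dilations:
  fixes \<mu> :: "(real^'n) measure" and A :: "nat \<Rightarrow> real^'n^'n" and v :: "nat \<Rightarrow> real^'n"
  assumes p: "1 < p" and N: "1 \<le> N" and w: "\<And>i. i \<in> {1..N} \<Longrightarrow> 0 < w i"
    and \<mu>: "\<mu> \<in> prob_measures_p p" and v: "\<And>i. i \<in> {1..N} \<Longrightarrow> v i = v0"
    and Q: "transpose Q = Q" "Q ** Q = Q"
    and A: "\<And>i. i \<in> {1..N} \<Longrightarrow> A i = mat 1 - Q + \<zeta> i *\<^sub>R Q"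
    and \<zeta>: "\<And>i. i \<in> {1..N} \<Longrightarrow> 0 \<le> \<zeta> i" "0 < \<zeta> 1"
  shows "wasserstein_barycenters p N w (\<lambda>i. distr \<mu> borel (\<lambda>x. A i *v x + v i))
       = {distr \<mu> borel (\<lambda>x. xbar p N w A *v x + xbar p N w v)}"
proof -
  define s where "s = xbar p N w \<zeta>"
  \<comment> \<open>Up to the factor \<open>p\<close>, the scalar gradient at
    \<open>\<zeta> i - s\<close>; the first-order condition for \<open>s\<close> therefore gives
    \<open>g0\<close>, which cancels the \<open>\<psi> i\<close>.\<close>
  define g where "g i = sgn (\<zeta> i - s) * \<bar>\<zeta> i - s\<bar> powr (p - 1)" for i
  define q where "q x = Q *v (x - v0)" for x
  define \<phi> where "\<phi> i x = (w i * g i * \<zeta> i powr (1 - p)) * norm (q x) powr p" for i x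
  define \<psi> where "\<psi> i z = (- (w i * g i * s powr (1 - p))) * norm (q z) powr p" for i z
  \<comment> \<open>Keeps the kernel component and rescales the \<open>Q\<close>-component, turning
    the factor \<open>\<zeta> 1\<close> into \<open>s\<close>.\<close>
  define R where "R x = x - q x + (s / \<zeta> 1) *\<^sub>R q x" for x
  have i1: "1 \<in> {1..N}" using N by simp
  have s: "0 < s" unfolding s_def using p N w \<zeta> by (intro xbar_pos) auto
  have crit: "(\<Sum>i=1..N. w i * norm_powr_grad p (\<zeta> i - s)) = 0"
    using xbar_critical[OF p w N, where x=\<zeta>] by (simp add: s_def)
  then have "p * (\<Sum>i=1..N. w i * g i) = 0"
    by (simp add: norm_powr_grad_real g_def sum_distrib_left mult_ac)
  then have g0: "(\<Sum>i=1..N. w i * g i) = 0" using p by simp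
  have QQ: "Q *v (Q *v x) = Q *v x" for x by (simp add: matrix_vector_mul_assoc Q)
  have xv: "xbar p N w v = v0"
    using p w N by (rule xbar_eqI) (assumption, intro sum.neutral ballI, simp add: v)
  have xA: "xbar p N w A = mat 1 - Q + s *\<^sub>R Q"
    using p w N
  proof (rule xbar_eqI)
    have "w i *\<^sub>R norm_powr_grad p (A i - (mat 1 - Q + s *\<^sub>R Q))
        = (w i * norm_powr_grad p (\<zeta> i - s)) *\<^sub>R (norm Q powr (p - 2) *\<^sub>R Q)" if "i \<in> {1..N}" for i
    proof -
      have "A i - (mat 1 - Q + s *\<^sub>R Q) = (\<zeta> i - s) *\<^sub>R Q"
        using A[OF that] by (simp add: scaleR_left_diff_distrib)
      then show ?thesis by (simp add: norm_powr_grad_def powr_mult mult_ac)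
    qed
    then have "(\<Sum>i=1..N. w i *\<^sub>R norm_powr_grad p (A i - (mat 1 - Q + s *\<^sub>R Q)))
        = (\<Sum>i=1..N. w i * norm_powr_grad p (\<zeta> i - s)) *\<^sub>R (norm Q powr (p - 2) *\<^sub>R Q)"
      by (subst scaleR_left.sum) (intro sum.cong refl, blast)
    then show "(\<Sum>i=1..N. w i *\<^sub>R norm_powr_grad p (A i - (mat 1 - Q + s *\<^sub>R Q))) = 0"
      by (simp only: crit) simp
  qed auto
  have pot: "\<phi> i x + \<psi> i z = w i * ray_potential p (\<zeta> i) s (q x) (q z)" for i x z
    by (simp add: \<phi>_def \<psi>_def g_def ray_potential_def algebra_simps)
  have q_diff: "q x - q z = Q *v (x - z)" for x z
    by (simp add: q_def flip: matrix_vector_mult_diff_distrib)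
  have norm_q: "norm (q x - q z) \<le> norm (x - z)" for x z
  proof -
    have "(norm (Q *v (x - z)))\<^sup>2 \<le> (norm (x - z))\<^sup>2"
      using orthogonal_projection_norm[OF Q, of "x - z"] zero_le_power2[of "norm (x - z - Q *v (x - z))"]
      by linarith
    then show ?thesis unfolding q_diff by (rule power2_le_imp_le) (rule norm_ge_zero)
  qed
  \<comment> \<open>For \<open>\<zeta> i = 0\<close> the bound is claimed only where
    \<open>q x = 0\<close>; the image of the corresponding affine map consists of such
    points.\<close>
  have le: "\<phi> i x + \<psi> i z \<le> w i * dist x z powr p"
    if i: "i \<in> {1..N}" and 0: "\<zeta> i = 0 \<Longrightarrow> q x = 0" for i x z
  proof -
    have "ray_potential p (\<zeta> i) s (q x) (q z) \<le> norm (q x - q z) powr p"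
      using p s \<zeta>(1)[OF i] 0 by (intro ray_potential_le) auto
    also have "\<dots> \<le> norm (x - z) powr p"
      using norm_q p by (intro powr_mono2) auto
    finally show ?thesis
      unfolding pot dist_norm using w[OF i] by (intro mult_left_mono) auto
  qed
  have affine: "(mat 1 - Q + t *\<^sub>R Q) *v x = x - Q *v x + t *\<^sub>R (Q *v x)" for t x
    by (simp add: matrix_vector_mult_add_rdistrib matrix_vector_mult_diff_rdistrib scaleR_matrix_vector_assoc)
  have qT: "q ((mat 1 - Q + t *\<^sub>R Q) *v x + v0) = t *\<^sub>R (Q *v x)" for t x
    by (simp add: q_def affine matrix_vector_right_distrib matrix_vector_mult_diff_distrib
        matrix_vector_mult_scaleR QQ)
  have growth: "\<exists>C. \<forall>x. \<bar>k * norm (q x) powr p\<bar> \<le> C * (1 + norm x powr p)" for k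
  proof -
    obtain C where C: "\<And>x. norm (Q *v x + - (Q *v v0)) powr p \<le> C * (1 + norm x powr p)"
      using norm_affine_powr_growth[of p Q "- (Q *v v0)"] p by auto
    have "\<bar>k * norm (q x) powr p\<bar> \<le> (\<bar>k\<bar> * C) * (1 + norm x powr p)" for x
      using mult_left_mono[OF C[of x], of "\<bar>k\<bar>"]
      by (simp add: q_def matrix_vector_mult_diff_distrib abs_mult mult.assoc)
    then show ?thesis by blast
  qed
  have q_cont: "continuous_on UNIV q"
    unfolding q_def by (intro continuous_intros)
  then have q_cont': "continuous_on UNIV (\<lambda>x. k * norm (q x) powr p)" for k
    using p by (intro continuous_on_powr' continuous_intros) auto
  show ?thesis
  proof (rule wasserstein_barycenters_pushforward[where \<phi>=\<phi> and \<psi>=\<psi> and R=R])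
    show "0 < p" "1 \<le> N" "\<And>i. i \<in> {1..N} \<Longrightarrow> 0 < w i" "sets \<mu> = sets borel"
      using p N w prob_measures_pD[OF \<mu>] by auto
    show "distr \<mu> borel (\<lambda>x. A i *v x + v i) \<in> prob_measures_p p"
      "distr \<mu> borel (\<lambda>x. xbar p N w A *v x + xbar p N w v) \<in> prob_measures_p p" for i
      using p \<mu> by (auto intro!: distr_affine_in_prob_measures_p)
    show "continuous_on UNIV (\<phi> i)" "continuous_on UNIV (\<psi> i)"
      "\<exists>C. \<forall>x. \<bar>\<phi> i x\<bar> \<le> C * (1 + norm x powr p)" "\<exists>C. \<forall>x. \<bar>\<psi> i x\<bar> \<le> C * (1 + norm x powr p)" for i
      unfolding \<phi>_def \<psi>_def by (rule q_cont' growth)+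
    show "continuous_on UNIV R" unfolding R_def by (intro continuous_intros q_cont)
    show "\<phi> i (A i *v x + v i) + \<psi> i z \<le> w i * dist (A i *v x + v i) z powr p"
      if i: "i \<in> {1..N}" for i x z
    proof (rule le[OF i])
      have "q (A i *v x + v i) = \<zeta> i *\<^sub>R (Q *v x)" by (simp only: A[OF i] v[OF i] qT)
      then show "q (A i *v x + v i) = 0" if "\<zeta> i = 0" using that by simp
    qed
    show "\<phi> i (A i *v x + v i) + \<psi> i (xbar p N w A *v x + xbar p N w v)
        = w i * dist (A i *v x + v i) (xbar p N w A *v x + xbar p N w v) powr p"
      if i: "i \<in> {1..N}" for i x
    proof -
      have "(A i *v x + v i) - (xbar p N w A *v x + xbar p N w v) = \<zeta> i *\<^sub>R (Q *v x) - s *\<^sub>R (Q *v x)"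
        by (simp add: A[OF i] v[OF i] xA xv affine)
      moreover have "ray_potential p (\<zeta> i) s (\<zeta> i *\<^sub>R (Q *v x)) (s *\<^sub>R (Q *v x))
          = norm (\<zeta> i *\<^sub>R (Q *v x) - s *\<^sub>R (Q *v x)) powr p"
        using p s \<zeta>(1)[OF i] by (intro ray_potential_eq) (auto simp: mult.commute)
      ultimately show ?thesis
        unfolding pot dist_norm by (simp only: A[OF i] v[OF i] xA xv qT)
    qed
    have "(\<Sum>i=1..N. \<psi> i z) = - ((\<Sum>i=1..N. w i * g i) * (s powr (1 - p) * norm (q z) powr p))" for z
      by (simp add: \<psi>_def sum_negf sum_distrib_right mult.assoc)
    then show "(\<Sum>i=1..N. \<psi> i z) = 0" for z by (simp only: g0)
    show "\<phi> 1 x + \<psi> 1 z \<le> w 1 * dist x z powr p" for x z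
      using \<zeta>(2) i1 by (intro le) auto
    show "z = R x" if "\<phi> 1 x + \<psi> 1 z = w 1 * dist x z powr p" for x z
    proof -
      have e: "ray_potential p (\<zeta> 1) s (q x) (q z) = norm (x - z) powr p"
        using that w[OF i1] unfolding pot dist_norm by simp
      have le1: "ray_potential p (\<zeta> 1) s (q x) (q z) \<le> norm (q x - q z) powr p"
        using p s \<zeta>(2) by (intro ray_potential_le) auto
      \<comment> \<open>Equality must hold throughout \<open>le\<close>. Here this says that
        projecting loses no length, so by Pythagoras \<open>x - z\<close> has no kernel component;
        then equality in the ray bound puts \<open>q x\<close> and \<open>q z\<close> on a common
        ray.\<close>
      have "norm (q x - q z) = norm (x - z)"
      proof (rule ccontr)
        assume "norm (q x - q z) \<noteq> norm (x - z)"
        then have "norm (q x - q z) powr p < norm (x - z) powr p"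
          using norm_q[of x z] p by (intro powr_less_mono2) auto
        then show False using e le1 by simp
      qed
      then have 1: "x - z = q x - q z" and 2: "norm (q x - q z) powr p = norm (x - z) powr p"
        using orthogonal_projection_norm[OF Q, of "x - z"] by (auto simp: q_diff)
      have "s *\<^sub>R q x = \<zeta> 1 *\<^sub>R q z"
        using ray_potential_less[OF p s \<zeta>(2), of "q x" "q z"] e 2 by fastforce
      then have "(1 / \<zeta> 1) *\<^sub>R (s *\<^sub>R q x) = (1 / \<zeta> 1) *\<^sub>R (\<zeta> 1 *\<^sub>R q z)" by simp
      then have "(s / \<zeta> 1) *\<^sub>R q x = q z"
        using \<zeta>(2) by simp
      then show ?thesis using 1 by (simp add: R_def algebra_simps)
    qed
    show "continuous_on UNIV (\<lambda>x. A i *v x + v i)" 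
      "continuous_on UNIV (\<lambda>x. xbar p N w A *v x + xbar p N w v)" for i
      by (intro continuous_intros)+
  qed
qed

section \<open>Reduction of the matrix hypotheses to a single projection\<close>

theorem proposition5p2:
  fixes p :: real and N :: nat and w :: "nat \<Rightarrow> real"
    and \<mu> :: "(real^'n) measure"
    and A :: "nat \<Rightarrow> real^'n^'n" and v :: "nat \<Rightarrow> real^'n"
  assumes "1 < p"
    and "\<forall>i\<in>{1..N}. 0 < w i" and "(\<Sum>i=1..N. w i) = 1"
    and "\<mu> \<in> prob_measures_p p" and "absolutely_continuous lborel \<mu>"
    and "(\<forall>i\<in>{1..N}. A i = mat 1)
       \<or> ((\<exists>v0. \<forall>i\<in>{1..N}. v i = v0)
          \<and> invertible (A 1)
          \<and> (\<forall>i\<in>{1..N}. transpose (A i) = A i \<and> pos_semidef (A i))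
          \<and> (\<forall>i\<in>{1..N}. \<exists>\<zeta>::real. 0 \<le> \<zeta> \<and> matrix_spectrum (A i) \<subseteq> {1, complex_of_real \<zeta>})
          \<and> (\<forall>i\<in>{1..N}. \<forall>j\<in>{1..N}. A i ** A j = A j ** A i)
          \<and> (\<forall>i\<in>{1..N}. \<forall>j\<in>{1..N}. A i \<noteq> mat 1 \<longrightarrow> A j \<noteq> mat 1 \<longrightarrow>
               eigenspace (A i) 1 = eigenspace (A j) 1))"
  shows "wasserstein_barycenters p N w (\<lambda>i. distr \<mu> borel (\<lambda>x. A i *v x + v i))
       = {distr \<mu> borel (\<lambda>x. xbar p N w A *v x + xbar p N w v)}"
proof -
  have N: "1 \<le> N" using assms(3) by (cases N) auto
  have w: "0 < w i" if "i \<in> {1..N}" for i using assms(2) that by blast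
  show ?thesis
  proof (cases "\<forall>i\<in>{1..N}. A i = mat 1")
    case True
    then show ?thesis using N w assms(1,4) by (intro wasserstein_barycenters_translates) auto
  next
    case False
    then obtain j where j: "j \<in> {1..N}" "A j \<noteq> mat 1" by blast
    obtain v0 where v0: "\<And>i. i \<in> {1..N} \<Longrightarrow> v i = v0" using False assms(6) by blast
    have inv: "invertible (A 1)" using False assms(6) by blast
    have sym: "\<And>i. i \<in> {1..N} \<Longrightarrow> transpose (A i) = A i" using False assms(6) by blast
    have "\<forall>i\<in>{1..N}. \<exists>\<zeta>::real. 0 \<le> \<zeta> \<and> matrix_spectrum (A i) \<subseteq> {1, complex_of_real \<zeta>}"
      using False assms(6) by blast
    then obtain \<zeta> where \<zeta>: "\<And>i. i \<in> {1..N} \<Longrightarrow> (0::real) \<le> \<zeta> i"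
      "\<And>i. i \<in> {1..N} \<Longrightarrow> matrix_spectrum (A i) \<subseteq> {1, complex_of_real (\<zeta> i)}" by metis
    have eig: "eigenspace (A i) 1 = eigenspace (A j) 1" if "i \<in> {1..N}" "A i \<noteq> mat 1" for i
      using that j False assms(6) by blast
    obtain Q where Q: "transpose Q = Q" "Q ** Q = Q" "A j = mat 1 - Q + \<zeta> j *\<^sub>R Q"
      "eigenspace (A j) 1 = {x. Q *v x = 0}"
      using symmetric_matrix_two_eigenvalues[OF sym \<zeta>(2)] j by metis
    \<comment> \<open>For an identity matrix the spectral condition leaves \<open>\<zeta> i\<close>
      arbitrary, but the common form with \<open>Q\<close> requires the factor
      \<open>1\<close>.\<close>
    define \<zeta>' where "\<zeta>' i = (if A i = mat 1 then 1 else \<zeta> i)" for i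
    have A: "A i = mat 1 - Q + \<zeta>' i *\<^sub>R Q" if i: "i \<in> {1..N}" for i
    proof (cases "A i = mat 1")
      case False
      obtain Q' where Q': "transpose Q' = Q'" "Q' ** Q' = Q'" "A i = mat 1 - Q' + \<zeta> i *\<^sub>R Q'"
        "eigenspace (A i) 1 = {x. Q' *v x = 0}"
        using symmetric_matrix_two_eigenvalues[OF sym[OF i] \<zeta>(2)[OF i] False] by metis
      have "{x. Q' *v x = 0} = {x. Q *v x = 0}"
        using eig[OF i False] unfolding Q(4) Q'(4) .
      then have "Q' = Q" by (rule orthogonal_projection_eqI[OF Q'(1,2) Q(1,2)])
      then show ?thesis using Q'(3) False by (simp add: \<zeta>'_def)
    qed (simp add: \<zeta>'_def)
    have i1: "1 \<in> {1..N}" using N by simp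
    \<comment> \<open>Otherwise \<open>A 1\<close> annihilates the range of \<open>Q\<close>;
      invertibility then forces \<open>Q = 0\<close>, contradicting the choice of
      \<open>j\<close>.\<close>
    have "\<zeta>' 1 \<noteq> 0"
    proof
      assume "\<zeta>' 1 = 0"
      then have "A 1 = mat 1 - Q" using A[OF i1] by simp
      moreover have "Q *v (Q *v x) = Q *v x" for x by (simp add: matrix_vector_mul_assoc Q)
      ultimately have "A 1 ** Q = 0"
        by (simp add: matrix_eq matrix_vector_mult_diff_rdistrib flip: matrix_vector_mul_assoc)
      obtain B where B: "B ** A 1 = mat 1" using inv by (auto simp: invertible_def)
      have "Q = (B ** A 1) ** Q" unfolding B by simp
      also have "\<dots> = B ** (A 1 ** Q)" by (rule matrix_mul_assoc[symmetric])
      also have "\<dots> = 0" unfolding \<open>A 1 ** Q = 0\<close> by (rule times0_right)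
      finally have "Q = 0" .
      then show False using Q(3) j by simp
    qed
    moreover have \<zeta>': "0 \<le> \<zeta>' i" if "i \<in> {1..N}" for i using \<zeta>(1)[OF that] by (simp add: \<zeta>'_def)
    ultimately have "0 < \<zeta>' 1" using \<zeta>'[OF i1] by simp
    with assms(1) N w assms(4) v0 Q(1,2) A \<zeta>' show ?thesis
      by (intro wasserstein_barycenters_dilations[where \<zeta>=\<zeta>' and Q=Q and ?v0.0=v0])
  qed
qed

end
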